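(* Let $\sigma,\theta,\mu$ be cardinals with $\sigma$ and $\theta$ regular and $\aleph_0<\sigma\leq\mathrm{cf}(\mu)<\theta<\mu$, and let $M$ be an elementary submodel of $H(\chi)$ for some sufficiently large regular cardinal $\chi$, with $\mu+1\subseteq M$. Assume: ($\circledast$) for every $A\in M$ with $A\subseteq\mu\cap\mathrm{Reg}$ and $|A|<\mu$, the set $M\cap\prod A$ is $(\theta,\sigma)$-cofinal in $\prod A$ modulo the ideal of subsets of $\mu$ bounded in $\mu$; that is, for every $B\subseteq A$ with $|B|<\theta$ and every $g\in\prod B$ there are $F_0\subseteq M\cap\prod A$ with $|F_0|<\sigma$ and $\zeta<\mu$ such that for every $b\in B\setminus\zeta$ there is $f\in F_0$ with $g(b)<f(b)$. Then $M\cap[\mu]^{<\mu}$ $\sigma$-covers $[\mu]^{<\theta}$: every subset of $\mu$ of cardinality less than $\theta$ is covered by a union of fewer than $\sigma$ members of $M\cap[\mu]^{<\mu}$.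
   Context: $\mathrm{Reg}$ denotes the class of regular cardinals; $H(\chi)$ is the collection of sets hereditarily of cardinality $<\chi$. For a set $A$ of regular cardinals, $\prod A$ is the set of functions $f$ with domain $A$ and $f(a)<a$ for all $a\in A$. $[\mu]^{<\kappa}$ is the set of subsets of $\mu$ of cardinality $<\kappa$. *)

theory Defs
  imports Main
begin

unbundle cardinal_syntax

section \<open>A universe of well-founded sets\<close>

text \<open>
  Cardinals, functions and elementary submodels are treated as genuine sets, so a type of
  hereditary sets is constructed here. A code \<open>Family f\<close> stands for the set of
  all \<open>f i\<close>; codes are identified when they denote the same set. The resulting type
  \<open>'k hset\<close> consists of all sets that are hereditarily of size at most the cardinality of
  \<open>'k + nat\<close>. It satisfies extensionality and foundation, and every subcollection of
  size at most that of \<open>'k + nat\<close> is a set (lemmas \<open>hset_ext\<close>, \<open>wf_mem_rel\<close>,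
  \<open>small_iff\<close> below). As \<open>'k\<close> is an arbitrary type, the size of the universe is arbitrary.
\<close>

datatype 'k set_code = Empty | Family "'k + nat \<Rightarrow> 'k set_code"

primrec kids :: "'k set_code \<Rightarrow> 'k set_code set" where
  "kids Empty = {}"
| "kids (Family f) = range f"

primrec ceq :: "'k set_code \<Rightarrow> 'k set_code \<Rightarrow> bool" where
  "ceq Empty = (\<lambda>d. kids d = {})"
| "ceq (Family f) = (\<lambda>d. (\<forall>i. \<exists>e\<in>kids d. ceq (f i) e) \<and> (\<forall>e\<in>kids d. \<exists>i. ceq (f i) e))"

lemma ceq_kids:
  "ceq c d \<longleftrightarrow> (\<forall>a\<in>kids c. \<exists>b\<in>kids d. ceq a b) \<and> (\<forall>b\<in>kids d. \<exists>a\<in>kids c. ceq a b)"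
  by (cases c) auto

lemma set_code_induct: "(\<And>c. (\<And>a. a \<in> kids c \<Longrightarrow> P a) \<Longrightarrow> P c) \<Longrightarrow> P c"
proof (induction c)
  case Empty
  then show ?case by (metis empty_iff kids.simps(1))
next
  case (Family f)
  have "\<And>a. a \<in> kids (Family f) \<Longrightarrow> P a"
    using Family by auto
  then show ?case using Family.prems by blast
qed

lemma ceq_refl: "ceq c c"
proof (induction c rule: set_code_induct)
  case (1 c)
  then show ?case by (subst ceq_kids) blast
qed

lemma ceq_sym: "ceq c d \<Longrightarrow> ceq d c"
proof (induction c arbitrary: d rule: set_code_induct)
  case (1 c)
  have "\<forall>a\<in>kids c. \<exists>b\<in>kids d. ceq a b" "\<forall>b\<in>kids d. \<exists>a\<in>kids c. ceq a b"
    using 1(2) by (simp_all add: ceq_kids[of c d])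
  with 1(1) show ?case by (subst ceq_kids) meson
qed

lemma ceq_trans: "ceq c d \<Longrightarrow> ceq d e \<Longrightarrow> ceq c e"
proof (induction c arbitrary: d e rule: set_code_induct)
  case (1 c)
  have "\<forall>a\<in>kids c. \<exists>b\<in>kids d. ceq a b" "\<forall>b\<in>kids d. \<exists>a\<in>kids c. ceq a b"
    using 1(2) by (simp_all add: ceq_kids[of c d])
  moreover have "\<forall>a\<in>kids d. \<exists>b\<in>kids e. ceq a b" "\<forall>b\<in>kids e. \<exists>a\<in>kids d. ceq a b"
    using 1(3) by (simp_all add: ceq_kids[of d e])
  ultimately show ?case using 1(1) by (subst ceq_kids) meson
qed

quotient_type 'k hset = "'k set_code" / ceq
  by (rule equivpI, rule reflpI, rule ceq_refl, rule sympI, erule ceq_sym, rule transpI,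
      erule ceq_trans, assumption)

definition elts :: "'k hset \<Rightarrow> 'k hset set" where
  "elts x = abs_hset ` kids (rep_hset x)"

lemma ceq_iff: "ceq c d \<longleftrightarrow> abs_hset c = abs_hset d"
  using Quotient3_rel[OF Quotient3_hset, of c d] by (simp add: ceq_refl)

lemma abs_rep_hset: "abs_hset (rep_hset x) = x"
  by (rule Quotient3_abs_rep[OF Quotient3_hset])

lemma abs_hset_eq_iff: "abs_hset c = abs_hset d \<longleftrightarrow> abs_hset ` kids c = abs_hset ` kids d"
proof -
  have "abs_hset c = abs_hset d \<longleftrightarrow>
      (\<forall>a\<in>kids c. \<exists>b\<in>kids d. abs_hset a = abs_hset b) \<and>
      (\<forall>b\<in>kids d. \<exists>a\<in>kids c. abs_hset a = abs_hset b)"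
    using ceq_kids[of c d] by (simp only: ceq_iff)
  also have "\<dots> \<longleftrightarrow> abs_hset ` kids c = abs_hset ` kids d"
  proof (intro iffI conjI)
    assume *: "(\<forall>a\<in>kids c. \<exists>b\<in>kids d. abs_hset a = abs_hset b) \<and>
      (\<forall>b\<in>kids d. \<exists>a\<in>kids c. abs_hset a = abs_hset b)"
    show "abs_hset ` kids c = abs_hset ` kids d"
    proof (rule subset_antisym; rule image_subsetI)
      show "abs_hset a \<in> abs_hset ` kids d" if "a \<in> kids c" for a
        using * that by (simp add: image_iff)
    next
      fix b assume "b \<in> kids d"
      then obtain a where a: "a \<in> kids c" "abs_hset a = abs_hset b" using * by blast
      show "abs_hset b \<in> abs_hset ` kids c"
        unfolding a(2)[symmetric] using a(1) by (rule imageI)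
    qed
  next
    assume *: "abs_hset ` kids c = abs_hset ` kids d"
    show "\<forall>a\<in>kids c. \<exists>b\<in>kids d. abs_hset a = abs_hset b"
    proof
      fix a assume "a \<in> kids c"
      then have "abs_hset a \<in> abs_hset ` kids d" unfolding *[symmetric] by (rule imageI)
      then show "\<exists>b\<in>kids d. abs_hset a = abs_hset b" by (simp add: image_iff)
    qed
    show "\<forall>b\<in>kids d. \<exists>a\<in>kids c. abs_hset a = abs_hset b"
    proof
      fix b assume "b \<in> kids d"
      then have "abs_hset b \<in> abs_hset ` kids c" unfolding * by (rule imageI)
      then show "\<exists>a\<in>kids c. abs_hset a = abs_hset b" by (elim imageE) (rule bexI, rule sym)
    qed
  qed
  finally show ?thesis .
qed

lemma elts_abs: "elts (abs_hset c) = abs_hset ` kids c"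
  unfolding elts_def by (rule iffD1[OF abs_hset_eq_iff abs_rep_hset])

lemma hset_ext: "elts x = elts y \<Longrightarrow> x = y"
  using abs_hset_eq_iff[of "rep_hset x" "rep_hset y"] by (simp add: elts_def abs_rep_hset)

definition mem_rel :: "('k hset \<times> 'k hset) set" where
  "mem_rel = {(x, y). x \<in> elts y}"

lemma wf_mem_rel: "wf mem_rel"
proof (rule wfUNIVI)
  fix P :: "'k hset \<Rightarrow> bool" and x
  assume step: "\<forall>x. (\<forall>y. (y, x) \<in> mem_rel \<longrightarrow> P y) \<longrightarrow> P x"
  have "P (abs_hset c)" for c
  proof (induction c rule: set_code_induct)
    case (1 c)
    have "\<forall>y. (y, abs_hset c) \<in> mem_rel \<longrightarrow> P y"
      using 1 unfolding mem_rel_def by (auto simp: elts_abs)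
    then show ?case using step by blast
  qed
  from this[of "rep_hset x"] show "P x" by (simp only: abs_rep_hset)
qed

lemma small_iff: "A \<in> range elts \<longleftrightarrow> |A| \<le>o |UNIV :: ('k + nat) set|"
  for A :: "'k hset set"
proof
  assume "A \<in> range elts"
  then obtain x where A: "A = elts x" by blast
  have "|kids c| \<le>o |UNIV :: ('k + nat) set|" for c :: "'k set_code"
    by (cases c) (simp_all add: card_of_image card_of_empty)
  then show "|A| \<le>o |UNIV :: ('k + nat) set|"
    unfolding A elts_def by (rule ordLeq_transitive[OF card_of_image])
next
  assume le: "|A| \<le>o |UNIV :: ('k + nat) set|"
  show "A \<in> range elts"
  proof (cases "A = {}")
    case True
    then have "elts (abs_hset Empty) = A" by (simp add: elts_abs)
    then show ?thesis by (rule range_eqI[OF sym])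
  next
    case False
    with le obtain h :: "'k + nat \<Rightarrow> 'k hset" where h: "h ` UNIV = A"
      unfolding card_of_ordLeq2[OF False, symmetric] by blast
    have "elts (abs_hset (Family (\<lambda>i. rep_hset (h i)))) = A"
      using h by (simp add: elts_abs image_image abs_rep_hset)
    then show ?thesis by (rule range_eqI[OF sym])
  qed
qed

lemma finite_small: "finite A \<Longrightarrow> A \<in> range elts"
  for A :: "'k hset set"
proof -
  assume "finite A"
  then obtain h :: "'k hset \<Rightarrow> nat" where "inj_on h A"
    using finite_imp_inj_to_nat_seg by blast
  then have "inj_on (\<lambda>x. Inr (h x) :: 'k + nat) A"
    by (simp add: inj_on_def)
  then show ?thesis
    unfolding small_iff by (rule card_of_ordLeqI) simp
qed

text \<open>\<open>hset_of A\<close> is the set with exactly the members \<open>A\<close>; meaningful for \<open>A \<in> range elts\<close>.\<close>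

definition hset_of :: "'k hset set \<Rightarrow> 'k hset" where
  "hset_of = inv elts"

lemma elts_hset_of: "A \<in> range elts \<Longrightarrow> elts (hset_of A) = A"
  unfolding hset_of_def by (rule f_inv_into_f)

text \<open>
  The order is inclusion. On ordinals, strict inclusion is membership
  (lemma \<open>Ord_less_iff\<close>), so it is the usual order of ordinals and cardinals.
\<close>

instantiation hset :: (type) order
begin

definition less_eq_hset :: "'a hset \<Rightarrow> 'a hset \<Rightarrow> bool" where
  "less_eq_hset x y \<longleftrightarrow> elts x \<subseteq> elts y"

definition less_hset :: "'a hset \<Rightarrow> 'a hset \<Rightarrow> bool" where
  "less_hset x y \<longleftrightarrow> elts x \<subset> elts y"

instance
  by standard (auto simp: less_eq_hset_def less_hset_def intro: hset_ext)

end

section \<open>Ordinals and cardinals\<close>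

definition succ :: "'k hset \<Rightarrow> 'k hset" where
  "succ x = hset_of (insert x (elts x))"

lemma elts_succ: "elts (succ x) = insert x (elts x)"
  for x :: "'k hset"
proof -
  have "|elts x| \<le>o |UNIV :: ('k + nat) set|" "|{x}| \<le>o |UNIV :: ('k + nat) set|"
    using small_iff[of "elts x"] small_iff[of "{x}"] finite_small[of "{x}"] by simp_all
  then have "|{x} \<union> elts x| \<le>o |UNIV :: ('k + nat) set|"
    by (intro card_of_Un_ordLeq_infinite_Field) (simp_all add: Field_card_of card_of_card_order_on)
  then show ?thesis
    unfolding succ_def by (intro elts_hset_of) (simp add: small_iff)
qed

definition Transset :: "'k hset \<Rightarrow> bool" where
  "Transset x \<longleftrightarrow> (\<forall>y\<in>elts x. elts y \<subseteq> elts x)"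

definition Ord :: "'k hset \<Rightarrow> bool" where
  "Ord x \<longleftrightarrow> Transset x \<and> (\<forall>y\<in>elts x. Transset y)"

lemma Ord_in_Ord: "Ord \<alpha> \<Longrightarrow> \<beta> \<in> elts \<alpha> \<Longrightarrow> Ord \<beta>"
  unfolding Ord_def Transset_def by blast

lemma mem_irrefl: "x \<notin> elts x"
  using wf_not_refl[OF wf_mem_rel, of x] by (simp add: mem_rel_def)

lemma Transset_below_Ord:
  assumes "Transset \<alpha>" "Ord \<beta>" "elts \<alpha> \<subset> elts \<beta>"
  shows "\<alpha> \<in> elts \<beta>"
proof -
  have lin: "\<forall>y. Ord x \<longrightarrow> Ord y \<longrightarrow> x \<in> elts y \<or> x = y \<or> y \<in> elts x" for x :: "'a hset"
  proof (induction x rule: wf_induct_rule[OF wf_mem_rel])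
    case (1 x)
    show ?case
    proof (rule allI)
      fix y
      show "Ord x \<longrightarrow> Ord y \<longrightarrow> x \<in> elts y \<or> x = y \<or> y \<in> elts x"
      proof (induction y rule: wf_induct_rule[OF wf_mem_rel])
        case (1 y)
        note IHx = \<open>\<And>z. (z, x) \<in> mem_rel \<Longrightarrow> \<forall>y. Ord z \<longrightarrow> Ord y \<longrightarrow> z \<in> elts y \<or> z = y \<or> y \<in> elts z\<close>
        note IHy = 1
        show ?case
        proof (intro impI, rule ccontr)
          assume x: "Ord x" and y: "Ord y" and no: "\<not> (x \<in> elts y \<or> x = y \<or> y \<in> elts x)"
          have "z \<in> elts y" if "z \<in> elts x" for z
            using IHx[of z] that x y no Ord_in_Ord[OF x that]
            by (auto simp: mem_rel_def Ord_def Transset_def)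
          moreover have "z \<in> elts x" if "z \<in> elts y" for z
            using IHy[of z] that x y no Ord_in_Ord[OF y that]
            by (auto simp: mem_rel_def Ord_def Transset_def)
          ultimately have "x = y" by (intro hset_ext) blast
          with no show False by blast
        qed
      qed
    qed
  qed
  have \<alpha>: "Ord \<alpha>" using assms unfolding Ord_def by blast
  show ?thesis
    using lin[of \<alpha>] \<alpha> assms mem_irrefl[of \<beta>] by blast
qed

lemma Ord_less_iff: "Ord \<alpha> \<Longrightarrow> Ord \<beta> \<Longrightarrow> \<alpha> < \<beta> \<longleftrightarrow> \<alpha> \<in> elts \<beta>"
  using Transset_below_Ord[of \<alpha> \<beta>] mem_irrefl[of \<alpha>]
  by (auto simp: less_hset_def Ord_def Transset_def)

text \<open>
  The cardinality of a set \<open>A\<close> is below the cardinal \<open>\<kappa>\<close> iff \<open>|A| <o |elts \<kappa>|\<close>,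
  where \<open>|_|\<close> and \<open><o\<close> are the library's cardinality and comparison of cardinals.
\<close>

definition Card :: "'k hset \<Rightarrow> bool" where
  "Card \<kappa> \<longleftrightarrow> Ord \<kappa> \<and> (\<forall>\<alpha>\<in>elts \<kappa>. |elts \<alpha>| <o |elts \<kappa>| )"

definition aleph0 :: "'k hset" where
  "aleph0 = (LEAST \<alpha>. Ord \<alpha> \<and> infinite (elts \<alpha>))"

definition cofinal_map :: "('k hset \<Rightarrow> 'k hset) \<Rightarrow> 'k hset \<Rightarrow> 'k hset \<Rightarrow> bool" where
  "cofinal_map f \<beta> \<alpha> \<longleftrightarrow>
     f ` elts \<beta> \<subseteq> elts \<alpha> \<and> (\<forall>\<gamma>\<in>elts \<alpha>. \<exists>\<xi>\<in>elts \<beta>. \<gamma> \<le> f \<xi>)"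

definition cf :: "'k hset \<Rightarrow> 'k hset" where
  "cf \<alpha> = (LEAST \<beta>. Ord \<beta> \<and> (\<exists>f. cofinal_map f \<beta> \<alpha>))"

definition Reg :: "'k hset set" where
  "Reg = {\<kappa>. Card \<kappa> \<and> infinite (elts \<kappa>) \<and> cf \<kappa> = \<kappa>}"

definition subsets_lt :: "'k hset \<Rightarrow> 'k hset \<Rightarrow> 'k hset set" where
  "subsets_lt \<mu> \<kappa> = {x. elts x \<subseteq> elts \<mu> \<and> |elts x| <o |elts \<kappa>| }"

section \<open>Functions as sets of ordered pairs\<close>

definition opair :: "'k hset \<Rightarrow> 'k hset \<Rightarrow> 'k hset" where
  "opair x y = hset_of {hset_of {x}, hset_of {x, y}}"

lemma opair_inject: "opair x y = opair x' y' \<longleftrightarrow> x = x' \<and> y = y'"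
proof -
  have [simp]: "elts (hset_of A) = A" if "finite A" for A :: "'a hset set"
    using that by (simp add: elts_hset_of finite_small)
  have eq: "hset_of A = hset_of B \<longleftrightarrow> A = B" if "finite A" "finite B" for A B :: "'a hset set"
    using that by (metis elts_hset_of finite_small)
  show ?thesis
    by (auto simp: opair_def eq doubleton_eq_iff)
qed

definition is_function_on :: "'k hset \<Rightarrow> 'k hset \<Rightarrow> bool" where
  "is_function_on f A \<longleftrightarrow>
     (\<forall>p\<in>elts f. \<exists>x\<in>elts A. \<exists>y. p = opair x y) \<and>
     (\<forall>x\<in>elts A. \<exists>!y. opair x y \<in> elts f)"

definition app :: "'k hset \<Rightarrow> 'k hset \<Rightarrow> 'k hset" where
  "app f x = (THE y. opair x y \<in> elts f)"

definition prod_set :: "'k hset \<Rightarrow> 'k hset set" where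
  "prod_set A = {f. is_function_on f A \<and> (\<forall>a\<in>elts A. app f a \<in> elts a)}"

section \<open>The structure $H(\chi)$ and elementary submodels\<close>

definition trcl_elts :: "'k hset \<Rightarrow> 'k hset set" where
  "trcl_elts x = {y. (y, x) \<in> mem_rel\<^sup>+}"

definition H :: "'k hset \<Rightarrow> 'k hset set" where
  "H \<chi> = {x. |trcl_elts x| <o |elts \<chi>| }"

datatype fm =
    Mem nat nat
  | Eq nat nat
  | Neg fm
  | Conj fm fm
  | Exists nat fm

primrec sat :: "'k hset set \<Rightarrow> (nat \<Rightarrow> 'k hset) \<Rightarrow> fm \<Rightarrow> bool" where
  "sat D v (Mem i j) \<longleftrightarrow> v i \<in> elts (v j)"
| "sat D v (Eq i j) \<longleftrightarrow> v i = v j"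
| "sat D v (Neg p) \<longleftrightarrow> \<not> sat D v p"
| "sat D v (Conj p q) \<longleftrightarrow> sat D v p \<and> sat D v q"
| "sat D v (Exists i p) \<longleftrightarrow> (\<exists>x\<in>D. sat D (v(i := x)) p)"

definition elem_submodel :: "'k hset set \<Rightarrow> 'k hset set \<Rightarrow> bool" where
  "elem_submodel M N \<longleftrightarrow> M \<noteq> {} \<and> M \<subseteq> N \<and>
     (\<forall>p v. range v \<subseteq> M \<longrightarrow> (sat M v p \<longleftrightarrow> sat N v p))"

section \<open>Cofinality modulo bounded sets, and covering\<close>

text \<open>
  \<open>F\<close> is \<open>(\<theta>,\<sigma>)\<close>-cofinal in the product of \<open>A\<close> modulo the ideal of
  subsets of \<open>\<mu>\<close> bounded in \<open>\<mu>\<close>.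
\<close>

definition cofinal_mod_bounded ::
  "'k hset \<Rightarrow> 'k hset \<Rightarrow> 'k hset \<Rightarrow> 'k hset set \<Rightarrow> 'k hset \<Rightarrow> bool" where
  "cofinal_mod_bounded \<theta> \<sigma> \<mu> F A \<longleftrightarrow>
     (\<forall>B g. elts B \<subseteq> elts A \<and> |elts B| <o |elts \<theta>| \<and> g \<in> prod_set B \<longrightarrow>
        (\<exists>F0 \<zeta>. F0 \<subseteq> F \<and> |F0| <o |elts \<sigma>| \<and> \<zeta> \<in> elts \<mu> \<and>
           (\<forall>b \<in> elts B - elts \<zeta>. \<exists>f\<in>F0. app g b < app f b)))"

definition covers :: "'k hset \<Rightarrow> 'k hset set \<Rightarrow> 'k hset set \<Rightarrow> bool" where
  "covers \<sigma> P Q \<longleftrightarrow>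
     (\<forall>x\<in>Q. \<exists>C. C \<subseteq> P \<and> |C| <o |elts \<sigma>| \<and> elts x \<subseteq> (\<Union>c\<in>C. elts c))"

end

theory Submission
  imports Defs
begin

text \<open>
  The ladder system. Elementarity puts into \<open>M\<close> a function \<open>c\<close> with \<open>c(\<beta>) = cf \<beta>\<close> for \<open>\<beta> \<le> \<mu>\<close>
  and maps \<open>e\<^sub>\<beta>\<close> from \<open>cf \<beta>\<close> to \<open>\<beta>\<close> such that every \<open>\<alpha> < \<beta>\<close> is dominated by a tail of
  \<open>e\<^sub>\<beta>\<close>.

  Refinement. Let \<open>x\<close> be a subset of \<open>\<mu>\<close> of size below \<open>\<theta>\<close>, and let \<open>N \<in> M\<close> be a set of fewer than
  \<open>\<mu>\<close> ordinals \<open>\<le> \<mu>\<close>. For \<open>\<alpha> \<in> x\<close> let \<open>\<beta>(\<alpha>)\<close> be the least element of \<open>N\<close> that is \<open>\<ge> \<alpha>\<close>.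
  For a regular \<open>b \<ge> \<theta>\<close> the indices needed to climb above the \<open>\<alpha> \<in> x\<close> with \<open>cf \<beta>(\<alpha>) = b\<close> are
  bounded by some \<open>g(b) < b\<close>. The cofinality hypothesis bounds \<open>g\<close> above some \<open>\<zeta> < \<mu>\<close> by fewer
  than \<open>\<sigma>\<close> functions \<open>f \<in> M\<close>. The sets \<open>{e\<^sub>\<beta>(f(cf \<beta>)) | \<beta> \<in> N}\<close>, together with the set
  of all \<open>e\<^sub>\<beta>(\<xi>)\<close> with \<open>\<beta> \<in> N\<close> and \<open>\<xi> < max \<zeta> \<theta>\<close>, lie in \<open>M\<close>, have size below \<open>\<mu>\<close>, and meet
  every interval \<open>[\<alpha>, \<beta>(\<alpha>))\<close> that is not empty.

  Iterating the refinement \<open>\<omega>\<close> times from \<open>{\<mu>}\<close> yields fewer than \<open>\<sigma>\<close> sets, as \<open>\<sigma>\<close> is regular and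
  uncountable. They cover \<open>x\<close>: the least ordinal \<open>\<ge> \<alpha>\<close> occurring in any of them must be \<open>\<alpha>\<close>.
\<close>

section \<open>Ordinals and cardinals\<close>

lemma small_subset: "A \<subseteq> elts x \<Longrightarrow> A \<in> range elts"
  unfolding small_iff by (rule ordLeq_transitive[OF card_of_mono1]) (auto simp flip: small_iff)

lemma small_image: "A \<in> range elts \<Longrightarrow> f ` A \<in> range elts" for f :: "'k hset \<Rightarrow> 'k hset"
  unfolding small_iff by (rule ordLeq_transitive[OF card_of_image])

lemma Ord_Transset: "Ord \<alpha> \<Longrightarrow> \<beta> \<in> elts \<alpha> \<Longrightarrow> \<gamma> \<in> elts \<beta> \<Longrightarrow> \<gamma> \<in> elts \<alpha>"
  unfolding Ord_def Transset_def by blast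

text \<open>The intersection of two ordinals is transitive. Were it a proper subset of both, it
  would belong to both, hence to itself, against foundation.\<close>

lemma Ord_cases:
  assumes "Ord \<alpha>" "Ord \<beta>"
  obtains "\<alpha> \<le> \<beta>" | "\<beta> \<in> elts \<alpha>"
proof -
  define \<gamma> where "\<gamma> = hset_of (elts \<alpha> \<inter> elts \<beta>)"
  have \<gamma>: "elts \<gamma> = elts \<alpha> \<inter> elts \<beta>"
    unfolding \<gamma>_def by (rule elts_hset_of, rule small_subset[of _ \<alpha>]) blast
  have tr: "Transset \<gamma>"
    using assms unfolding Ord_def Transset_def \<gamma> by blast
  show thesis
  proof (cases "elts \<gamma> \<subset> elts \<alpha>")
    case True
    then have a: "\<gamma> \<in> elts \<alpha>" using Transset_below_Ord[OF tr assms(1)] by blast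
    have "\<not> elts \<gamma> \<subset> elts \<beta>"
      using Transset_below_Ord[OF tr assms(2)] a \<gamma> mem_irrefl[of \<gamma>] by blast
    then have "\<gamma> = \<beta>" using \<gamma> by (intro hset_ext) blast
    then show thesis using a that by blast
  next
    case False
    then show thesis using \<gamma> that(1) by (auto simp: less_eq_hset_def)
  qed
qed

lemma Ord_mem_imp_le: "Ord \<beta> \<Longrightarrow> \<alpha> \<in> elts \<beta> \<Longrightarrow> \<alpha> \<le> \<beta>"
  unfolding Ord_def Transset_def less_eq_hset_def by blast

lemma Ord_not_le_iff: "Ord \<alpha> \<Longrightarrow> Ord \<beta> \<Longrightarrow> \<not> \<alpha> \<le> \<beta> \<longleftrightarrow> \<beta> \<in> elts \<alpha>"
  by (rule Ord_cases[of \<alpha> \<beta>]) (use mem_irrefl[of \<beta>] in \<open>auto simp: less_eq_hset_def\<close>)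

lemma Ord_le_cases: "Ord \<beta> \<Longrightarrow> Ord \<alpha> \<Longrightarrow> \<alpha> \<le> \<beta> \<Longrightarrow> \<alpha> = \<beta> \<or> \<alpha> \<in> elts \<beta>"
  using Ord_less_iff[of \<alpha> \<beta>] by (auto simp: order.order_iff_strict)

lemma Ord_le_mem_trans: "Ord \<gamma> \<Longrightarrow> Ord \<alpha> \<Longrightarrow> \<alpha> \<le> \<beta> \<Longrightarrow> \<beta> \<in> elts \<gamma> \<Longrightarrow> \<alpha> \<in> elts \<gamma>"
  by (metis Ord_Transset Ord_in_Ord Ord_le_cases)

lemma Ord_exists_least:
  assumes "x \<in> S" "\<And>y. y \<in> S \<Longrightarrow> Ord y"
  obtains m where "m \<in> S" "\<And>y. y \<in> S \<Longrightarrow> m \<le> y"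
proof -
  obtain m where m: "m \<in> S" "\<And>y. (y, m) \<in> mem_rel \<Longrightarrow> y \<notin> S"
    using wfE_min[OF wf_mem_rel assms(1)] by metis
  have "m \<le> y" if "y \<in> S" for y
    using m that assms(2) Ord_not_le_iff[of m y] by (auto simp: mem_rel_def)
  then show thesis using that m by blast
qed

text \<open>Inclusion is only a partial order on sets, so \<open>LEAST\<close> need not be
  meaningful in general; for ordinals, foundation and linearity supply a true least element. This is
  needed for \<open>cf\<close> and \<open>aleph0\<close>.\<close>

lemma
  assumes "P \<alpha>" "Ord \<alpha>"
  shows Ord_LeastI: "Ord (LEAST \<alpha>. Ord \<alpha> \<and> P \<alpha>) \<and> P (LEAST \<alpha>. Ord \<alpha> \<and> P \<alpha>)"
    and Ord_Least_le: "(LEAST \<alpha>. Ord \<alpha> \<and> P \<alpha>) \<le> \<alpha>"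
proof -
  obtain m where m: "m \<in> {\<alpha>. Ord \<alpha> \<and> P \<alpha>}" "\<And>y. y \<in> {\<alpha>. Ord \<alpha> \<and> P \<alpha>} \<Longrightarrow> m \<le> y"
    using Ord_exists_least[of \<alpha> "{\<alpha>. Ord \<alpha> \<and> P \<alpha>}"] assms by blast
  then have "(LEAST \<alpha>. Ord \<alpha> \<and> P \<alpha>) = m"
    by (intro Least_equality) auto
  then show "Ord (LEAST \<alpha>. Ord \<alpha> \<and> P \<alpha>) \<and> P (LEAST \<alpha>. Ord \<alpha> \<and> P \<alpha>)"
    and "(LEAST \<alpha>. Ord \<alpha> \<and> P \<alpha>) \<le> \<alpha>"
    using m assms by auto
qed

text \<open>Bridge to the library, whose notions of cardinal order, regularity and stability concern
  well-order relations.\<close>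

definition le_rel :: "'k hset \<Rightarrow> 'k hset rel" where
  "le_rel \<alpha> = {(x, y). x \<in> elts \<alpha> \<and> y \<in> elts \<alpha> \<and> x \<le> y}"

lemma Field_le_rel: "Field (le_rel \<alpha>) = elts \<alpha>"
  unfolding le_rel_def Field_def by auto

lemma Well_order_le_rel:
  assumes "Ord \<alpha>"
  shows "Well_order (le_rel \<alpha>)"
proof -
  have "refl_on (elts \<alpha>) (le_rel \<alpha>)" "le_rel \<alpha> \<subseteq> elts \<alpha> \<times> elts \<alpha>" "trans (le_rel \<alpha>)" "antisym (le_rel \<alpha>)"
    by (auto simp: refl_on_def trans_def antisym_def le_rel_def)
  moreover have "total_on (elts \<alpha>) (le_rel \<alpha>)"
    unfolding total_on_def le_rel_def
    using Ord_not_le_iff Ord_mem_imp_le Ord_in_Ord[OF assms] by blast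
  moreover have "wf (le_rel \<alpha> - Id)"
  proof (rule wf_subset[OF wf_mem_rel], rule subrelI)
    fix x y assume "(x, y) \<in> le_rel \<alpha> - Id"
    then show "(x, y) \<in> mem_rel"
      using Ord_le_cases[of y x] Ord_in_Ord[OF assms] by (auto simp: le_rel_def mem_rel_def)
  qed
  ultimately show ?thesis
    unfolding well_order_on_def linear_order_on_def partial_order_on_def preorder_on_def Field_le_rel
    by blast
qed

lemma underS_le_rel:
  assumes "Ord \<alpha>" "\<beta> \<in> elts \<alpha>"
  shows "underS (le_rel \<alpha>) \<beta> = elts \<beta>"
proof -
  have "x \<in> elts \<alpha> \<and> x \<le> \<beta> \<and> x \<noteq> \<beta> \<longleftrightarrow> x \<in> elts \<beta>" for x
    using Ord_in_Ord[OF assms] Ord_Transset[OF assms] Ord_le_cases[of \<beta> x] Ord_in_Ord[OF assms(1)]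
      Ord_mem_imp_le[of \<beta> x] mem_irrefl[of \<beta>] by (metis assms(2))
  then show ?thesis using assms(2) unfolding underS_def le_rel_def by blast
qed

text \<open>A proper initial segment of \<open>le_rel \<kappa>\<close> consists of the elements of
  some member of \<kappa>, hence is smaller than \<kappa>; this is the library's criterion for a
  cardinal order.\<close>

lemma Card_order_le_rel:
  assumes "Card \<kappa>"
  shows "Card_order (le_rel \<kappa>)"
proof -
  have o: "Ord \<kappa>" using assms by (simp add: Card_def)
  have "Restr (le_rel \<kappa>) (underS (le_rel \<kappa>) a) <o |elts \<kappa>|" if a: "a \<in> elts \<kappa>" for a
  proof (rule ccontr)
    let ?r = "Restr (le_rel \<kappa>) (elts a)"
    have wo: "Well_order ?r" by (rule Well_order_Restr[OF Well_order_le_rel[OF o]])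
    assume "\<not> Restr (le_rel \<kappa>) (underS (le_rel \<kappa>) a) <o |elts \<kappa>|"
    then have "|elts \<kappa>| \<le>o ?r"
      using wo card_of_Well_order not_ordLess_iff_ordLeq unfolding underS_le_rel[OF o a] by blast
    then have "|Field |elts \<kappa>| | \<le>o |Field ?r|" by (rule card_of_mono2)
    moreover have "|Field ?r| \<le>o |elts a|" by (rule card_of_mono1) (auto simp: Field_def)
    ultimately have "|elts \<kappa>| \<le>o |elts a|" using ordLeq_transitive by (simp add: Field_card_of) blast
    then show False using assms a not_ordLess_ordLeq unfolding Card_def by blast
  qed
  then show ?thesis
    using Card_order_iff_Restr_underS[OF Well_order_le_rel[OF o]] by (simp add: Field_le_rel)
qed

lemma le_rel_ordIso: "Card \<kappa> \<Longrightarrow> |elts \<kappa>| =o le_rel \<kappa>"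
  using card_of_Field_ordIso[OF Card_order_le_rel] by (simp add: Field_le_rel)

lemma card_less_imp_surj_from_mem:
  assumes "Card \<kappa>" "|X| <o |elts \<kappa>|"
  obtains \<alpha> f where "\<alpha> \<in> elts \<kappa>" "f ` elts \<alpha> = X"
proof -
  have o: "Ord \<kappa>" using assms by (simp add: Card_def)
  have "|X| <o le_rel \<kappa>"
    using assms(2) le_rel_ordIso[OF assms(1)] by (rule ordLess_ordIso_trans)
  then obtain \<alpha> where \<alpha>: "\<alpha> \<in> elts \<kappa>" and iso: "|X| =o Restr (le_rel \<kappa>) (elts \<alpha>)"
    using ordLess_iff_ordIso_Restr[OF Well_order_le_rel[OF o] card_of_Well_order, of X]
      underS_le_rel[OF o] unfolding Field_le_rel by metis
  have "Field (Restr (le_rel \<kappa>) (elts \<alpha>)) = elts \<alpha>"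
    using Ord_Transset[OF o \<alpha>] by (auto simp: Field_def le_rel_def)
  then have "|X| =o |elts \<alpha>|"
    using card_of_cong[OF iso] by (simp add: Field_card_of)
  then obtain f where "bij_betw f (elts \<alpha>) X"
    using card_of_ordIso ordIso_symmetric by blast
  then show thesis using that \<alpha> bij_betw_imp_surj_on by blast
qed

section \<open>Cofinality\<close>

lemma
  assumes "Ord \<alpha>"
  shows Ord_cf: "Ord (cf \<alpha>)" and cf_cofinal: "\<exists>f. cofinal_map f (cf \<alpha>) \<alpha>" and cf_le_self: "cf \<alpha> \<le> \<alpha>"
proof -
  have *: "\<exists>f. cofinal_map f \<alpha> \<alpha>" by (rule exI[of _ id]) (auto simp: cofinal_map_def)
  show "Ord (cf \<alpha>)" "\<exists>f. cofinal_map f (cf \<alpha>) \<alpha>" "cf \<alpha> \<le> \<alpha>"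
    using Ord_LeastI[of "\<lambda>\<beta>. \<exists>f. cofinal_map f \<beta> \<alpha>" \<alpha>] Ord_Least_le[of "\<lambda>\<beta>. \<exists>f. cofinal_map f \<beta> \<alpha>" \<alpha>] * assms
    unfolding cf_def by blast+
qed

lemma cf_le: "Ord \<beta> \<Longrightarrow> cofinal_map f \<beta> \<alpha> \<Longrightarrow> cf \<alpha> \<le> \<beta>"
  unfolding cf_def by (rule Ord_Least_le, rule exI)

text \<open>By minimality of \<open>cf\<close>, a map from a smaller ordinal is not cofinal; any
  \<gamma> that no value reaches is a strict bound.\<close>

lemma bounded_below_cf:
  assumes "Ord \<alpha>" "\<beta> \<in> elts (cf \<alpha>)" "f ` elts \<beta> \<subseteq> elts \<alpha>"
  obtains \<gamma> where "\<gamma> \<in> elts \<alpha>" "\<And>\<xi>. \<xi> \<in> elts \<beta> \<Longrightarrow> f \<xi> \<in> elts \<gamma>"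
proof -
  have "Ord \<beta>" using assms Ord_cf Ord_in_Ord by blast
  then have "\<not> cofinal_map f \<beta> \<alpha>"
    using cf_le assms(2) mem_irrefl[of \<beta>] by (auto simp: less_eq_hset_def)
  then obtain \<gamma> where \<gamma>: "\<gamma> \<in> elts \<alpha>" "\<And>\<xi>. \<xi> \<in> elts \<beta> \<Longrightarrow> \<not> \<gamma> \<le> f \<xi>"
    using assms(3) by (auto simp: cofinal_map_def)
  show thesis
    using that[of \<gamma>] \<gamma> Ord_not_le_iff[of \<gamma>] Ord_in_Ord[OF assms(1)] assms(3) by blast
qed

text \<open>If some \<beta> below \<open>cf \<alpha>\<close> were not smaller in size, a surjection
  of \<beta> onto \<open>cf \<alpha>\<close> followed by a cofinal map would be unbounded in
  \<alpha>, against \<open>bounded_below_cf\<close>.\<close>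

lemma Card_cf:
  assumes "Ord \<alpha>"
  shows "Card (cf \<alpha>)"
  unfolding Card_def
proof (intro conjI ballI)
  show o: "Ord (cf \<alpha>)" by (rule Ord_cf[OF assms])
  fix \<beta> assume \<beta>: "\<beta> \<in> elts (cf \<alpha>)"
  obtain f where f: "cofinal_map f (cf \<alpha>) \<alpha>" using cf_cofinal[OF assms] by blast
  show "|elts \<beta>| <o |elts (cf \<alpha>)|"
  proof (rule ccontr)
    assume "\<not> |elts \<beta>| <o |elts (cf \<alpha>)|"
    then have "|elts (cf \<alpha>)| \<le>o |elts \<beta>|" by (simp add: not_ordLess_iff_ordLeq card_of_Well_order)
    then obtain h where h: "h ` elts \<beta> = elts (cf \<alpha>)"
      using card_of_ordLeq2[of "elts (cf \<alpha>)"] \<beta> by (metis empty_iff)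
    have "(f \<circ> h) ` elts \<beta> \<subseteq> elts \<alpha>" using f h unfolding cofinal_map_def by auto
    then obtain \<gamma> where \<gamma>: "\<gamma> \<in> elts \<alpha>" "\<And>\<xi>. \<xi> \<in> elts \<beta> \<Longrightarrow> f (h \<xi>) \<in> elts \<gamma>"
      using bounded_below_cf[OF assms \<beta>, of "f \<circ> h"] by (metis comp_apply)
    obtain \<xi> where "\<xi> \<in> elts (cf \<alpha>)" "\<gamma> \<le> f \<xi>" using f \<gamma> unfolding cofinal_map_def by blast
    moreover from this obtain \<eta> where "\<eta> \<in> elts \<beta>" "\<xi> = h \<eta>" using h by blast
    ultimately show False using \<gamma>(2)[of \<eta>] mem_irrefl[of "f \<xi>"] by (auto simp: less_eq_hset_def)
  qed
qed

text \<open>Let \<open>e \<xi>\<close> bound all values of a cofinal map at indices up to \<xi>.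
  Domination by a whole tail later allows an index to be replaced by any larger one.\<close>

lemma tail_cofinal_map:
  assumes "Ord \<alpha>"
  obtains e where "e ` elts (cf \<alpha>) \<subseteq> elts \<alpha>"
    "\<And>\<gamma>. \<gamma> \<in> elts \<alpha> \<Longrightarrow> \<exists>\<xi>0\<in>elts (cf \<alpha>). \<forall>\<xi>\<in>elts (cf \<alpha>). \<xi>0 \<le> \<xi> \<longrightarrow> \<gamma> \<le> e \<xi>"
proof -
  obtain f where f: "cofinal_map f (cf \<alpha>) \<alpha>" using cf_cofinal[OF assms] by blast
  have o: "Ord (cf \<alpha>)" by (rule Ord_cf[OF assms])
  have "\<exists>\<gamma>\<in>elts \<alpha>. \<forall>\<xi>'\<in>elts (cf \<alpha>). \<xi>' \<le> \<xi> \<longrightarrow> f \<xi>' \<le> \<gamma>" if \<xi>: "\<xi> \<in> elts (cf \<alpha>)" for \<xi>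
  proof -
    have "f ` elts \<xi> \<subseteq> elts \<alpha>"
      using f Ord_Transset[OF o \<xi>] unfolding cofinal_map_def by blast
    then obtain \<gamma> where \<gamma>: "\<gamma> \<in> elts \<alpha>" "\<And>\<xi>'. \<xi>' \<in> elts \<xi> \<Longrightarrow> f \<xi>' \<in> elts \<gamma>"
      using bounded_below_cf[OF assms \<xi>] by metis
    have f\<xi>: "f \<xi> \<in> elts \<alpha>" using f \<xi> unfolding cofinal_map_def by blast
    have or: "Ord \<gamma>" "Ord (f \<xi>)" using \<gamma> f\<xi> Ord_in_Ord assms by blast+
    \<comment> \<open>\<open>bounded_below_cf\<close> handles only the indices strictly below \<xi>;
      the maximum also takes care of \<xi> itself.\<close>
    define \<delta> where "\<delta> = (if \<gamma> \<le> f \<xi> then f \<xi> else \<gamma>)"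
    have \<delta>: "\<gamma> \<le> \<delta>" "f \<xi> \<le> \<delta>" "\<delta> \<in> elts \<alpha>"
      using \<gamma>(1) f\<xi> Ord_not_le_iff[OF or] Ord_mem_imp_le[OF or(1)] by (auto simp: \<delta>_def)
    have "f \<xi>' \<le> \<delta>" if "\<xi>' \<in> elts (cf \<alpha>)" "\<xi>' \<le> \<xi>" for \<xi>'
      using Ord_le_cases[OF Ord_in_Ord[OF o \<xi>] Ord_in_Ord[OF o that(1)] that(2)] \<delta>
        \<gamma>(2)[of \<xi>'] Ord_mem_imp_le[OF or(1), of "f \<xi>'"] by auto
    then show ?thesis using \<delta> by blast
  qed
  then obtain e where e: "\<And>\<xi>. \<xi> \<in> elts (cf \<alpha>) \<Longrightarrow> e \<xi> \<in> elts \<alpha> \<and> (\<forall>\<xi>'\<in>elts (cf \<alpha>). \<xi>' \<le> \<xi> \<longrightarrow> f \<xi>' \<le> e \<xi>)"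
    by metis
  show thesis
  proof (rule that[of e])
    show "e ` elts (cf \<alpha>) \<subseteq> elts \<alpha>" using e by blast
    fix \<gamma> assume "\<gamma> \<in> elts \<alpha>"
    then obtain \<xi>0 where "\<xi>0 \<in> elts (cf \<alpha>)" "\<gamma> \<le> f \<xi>0" using f unfolding cofinal_map_def by blast
    then show "\<exists>\<xi>0\<in>elts (cf \<alpha>). \<forall>\<xi>\<in>elts (cf \<alpha>). \<xi>0 \<le> \<xi> \<longrightarrow> \<gamma> \<le> e \<xi>"
      using e order_trans by blast
  qed
qed

text \<open>A cofinal map into \<open>cf \<alpha>\<close> followed by the tail-dominating
  \<open>e\<close> is cofinal in \<alpha>; the tail property replaces monotonicity.\<close>

lemma cf_idem:
  assumes "Ord \<alpha>"
  shows "cf (cf \<alpha>) = cf \<alpha>"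
proof (rule antisym)
  have o: "Ord (cf \<alpha>)" by (rule Ord_cf[OF assms])
  show "cf (cf \<alpha>) \<le> cf \<alpha>" by (rule cf_le_self[OF o])
  obtain e where e: "e ` elts (cf \<alpha>) \<subseteq> elts \<alpha>"
    "\<And>\<gamma>. \<gamma> \<in> elts \<alpha> \<Longrightarrow> \<exists>\<xi>0\<in>elts (cf \<alpha>). \<forall>\<xi>\<in>elts (cf \<alpha>). \<xi>0 \<le> \<xi> \<longrightarrow> \<gamma> \<le> e \<xi>"
    using tail_cofinal_map[OF assms] by metis
  obtain g where g: "cofinal_map g (cf (cf \<alpha>)) (cf \<alpha>)" using cf_cofinal[OF o] by blast
  have "cofinal_map (e \<circ> g) (cf (cf \<alpha>)) \<alpha>"
    unfolding cofinal_map_def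
  proof (intro conjI ballI)
    show "(e \<circ> g) ` elts (cf (cf \<alpha>)) \<subseteq> elts \<alpha>" using e(1) g unfolding cofinal_map_def by auto
    fix \<gamma> assume "\<gamma> \<in> elts \<alpha>"
    then obtain \<xi>0 where \<xi>0: "\<xi>0\<in>elts (cf \<alpha>)" "\<forall>\<xi>\<in>elts (cf \<alpha>). \<xi>0 \<le> \<xi> \<longrightarrow> \<gamma> \<le> e \<xi>" using e(2) by blast
    then obtain \<eta> where "\<eta> \<in> elts (cf (cf \<alpha>))" "\<xi>0 \<le> g \<eta>" using g unfolding cofinal_map_def by blast
    then show "\<exists>\<eta>\<in>elts (cf (cf \<alpha>)). \<gamma> \<le> (e \<circ> g) \<eta>"
      using \<xi>0 g unfolding cofinal_map_def by auto
  qed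
  then show "cf \<alpha> \<le> cf (cf \<alpha>)" by (rule cf_le[OF Ord_cf[OF o]])
qed

lemma cf_in_Reg: "Ord \<alpha> \<Longrightarrow> infinite (elts (cf \<alpha>)) \<Longrightarrow> cf \<alpha> \<in> Reg"
  by (simp add: Reg_def Card_cf cf_idem)

lemma Reg_Ord: "\<kappa> \<in> Reg \<Longrightarrow> Ord \<kappa>"
  by (simp add: Reg_def Card_def)

lemma Reg_bounded:
  assumes "\<kappa> \<in> Reg" "X \<subseteq> elts \<kappa>" "|X| <o |elts \<kappa>|"
  obtains \<gamma> where "\<gamma> \<in> elts \<kappa>" "X \<subseteq> elts \<gamma>"
proof -
  have c: "Card \<kappa>" "cf \<kappa> = \<kappa>" using assms(1) by (auto simp: Reg_def)
  obtain \<alpha> f where "\<alpha> \<in> elts \<kappa>" "f ` elts \<alpha> = X"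
    using card_less_imp_surj_from_mem[OF c(1) assms(3)] by metis
  then obtain \<gamma> where "\<gamma> \<in> elts \<kappa>" "\<And>\<xi>. \<xi> \<in> elts \<alpha> \<Longrightarrow> f \<xi> \<in> elts \<gamma>"
    using bounded_below_cf[OF Reg_Ord[OF assms(1)], of \<alpha> f] assms(2) c(2) by metis
  then show thesis using \<open>f ` elts \<alpha> = X\<close> that by blast
qed

text \<open>By \<open>Reg_bounded\<close> a cofinal subset of \<kappa> has full size, so
  \<open>le_rel \<kappa>\<close> is regular in the library's sense, hence stable; stability yields
  the bound on unions.\<close>

lemma Reg_UNION:
  assumes "\<kappa> \<in> Reg" "|I| <o |elts \<kappa>|" "\<And>i. i \<in> I \<Longrightarrow> |A i| <o |elts \<kappa>|"
  shows "|\<Union>i\<in>I. A i| <o |elts \<kappa>|"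
proof -
  have c: "Card \<kappa>" "infinite (elts \<kappa>)" using assms(1) by (auto simp: Reg_def)
  have "regularCard (le_rel \<kappa>)"
    unfolding regularCard_def Field_le_rel
  proof (intro allI impI, elim conjE, rule ccontr)
    fix K assume K: "K \<subseteq> elts \<kappa>" "cofinal K (le_rel \<kappa>)" "\<not> |K| =o le_rel \<kappa>"
    have "|K| \<le>o |elts \<kappa>|" using K(1) by (rule card_of_mono1)
    moreover have "\<not> |K| =o |elts \<kappa>|" using K(3) le_rel_ordIso[OF c(1)] ordIso_transitive by blast
    ultimately have "|K| <o |elts \<kappa>|" by (simp add: ordLeq_iff_ordLess_or_ordIso)
    then obtain \<gamma> where \<gamma>: "\<gamma> \<in> elts \<kappa>" "K \<subseteq> elts \<gamma>" using Reg_bounded[OF assms(1) K(1)] by metis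
    obtain b where "b \<in> K" "\<gamma> \<le> b"
      using K(2) \<gamma>(1) unfolding cofinal_def Field_le_rel by (auto simp: le_rel_def)
    then show False using \<gamma>(2) mem_irrefl unfolding less_eq_hset_def by blast
  qed
  then have "stable (le_rel \<kappa>)"
    using regularCard_stable[OF Card_order_le_rel[OF c(1)]] c(2) by (simp add: Field_le_rel)
  then show ?thesis
    using card_of_UNION_ordLess_infinite[OF stable_ordIso1[OF _ le_rel_ordIso[OF c(1)]] assms(2)] assms(3)
    by blast
qed

section \<open>The structure $H(\chi)$\<close>

lemma trcl_elts_unfold: "trcl_elts x = elts x \<union> (\<Union>y\<in>elts x. trcl_elts y)"
proof -
  have "(y, x) \<in> mem_rel\<^sup>+ \<longleftrightarrow> (y, x) \<in> mem_rel \<or> (\<exists>z. (y, z) \<in> mem_rel\<^sup>+ \<and> (z, x) \<in> mem_rel)" for y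
    by (meson trancl.simps)
  then show ?thesis unfolding trcl_elts_def mem_rel_def by blast
qed

lemma H_transitive: "x \<in> H \<chi> \<Longrightarrow> y \<in> elts x \<Longrightarrow> y \<in> H \<chi>"
  unfolding H_def using trcl_elts_unfold[of x] card_of_mono1[of "trcl_elts y" "trcl_elts x"] ordLeq_ordLess_trans
  by blast

lemma H_memI:
  assumes "\<chi> \<in> Reg" "elts x \<subseteq> H \<chi>" "|elts x| <o |elts \<chi>|"
  shows "x \<in> H \<chi>"
proof -
  have "|\<Union>y\<in>elts x. trcl_elts y| <o |elts \<chi>|"
    using assms by (intro Reg_UNION) (auto simp: H_def)
  moreover have "infinite (elts \<chi>)" using assms(1) by (simp add: Reg_def)
  ultimately show ?thesis
    unfolding H_def mem_Collect_eq trcl_elts_unfold[of x] using assms(3) card_of_Un_ordLess_infinite by blast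
qed

lemma small_if_card_less: "|A| <o |elts x| \<Longrightarrow> A \<in> range elts"
  for A :: "'k hset set" and x :: "'k hset"
  unfolding small_iff by (rule ordLeq_transitive[OF ordLess_imp_ordLeq]) (auto simp flip: small_iff)

lemma hset_of_in_H:
  assumes "\<chi> \<in> Reg" "A \<subseteq> H \<chi>" "|A| <o |elts \<chi>|"
  shows "hset_of A \<in> H \<chi>"
  using assms elts_hset_of[OF small_if_card_less[OF assms(3)]] by (intro H_memI) simp_all

lemma finite_card_less: "\<chi> \<in> Reg \<Longrightarrow> finite A \<Longrightarrow> |A| <o |elts \<chi>|"
  unfolding Reg_def by (metis (no_types, lifting) card_of_ordLeq_infinite card_of_Well_order mem_Collect_eq not_ordLess_iff_ordLeq)

lemma opair_in_H: "\<chi> \<in> Reg \<Longrightarrow> x \<in> H \<chi> \<Longrightarrow> y \<in> H \<chi> \<Longrightarrow> opair x y \<in> H \<chi>"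
  unfolding opair_def by (intro hset_of_in_H finite_card_less) (auto intro!: hset_of_in_H finite_card_less)

section \<open>Formulas and elementary submodels\<close>

definition Impl :: "fm \<Rightarrow> fm \<Rightarrow> fm" where
  "Impl p q = Neg (Conj p (Neg q))"

definition Disj :: "fm \<Rightarrow> fm \<Rightarrow> fm" where
  "Disj p q = Neg (Conj (Neg p) (Neg q))"

definition Forall :: "nat \<Rightarrow> fm \<Rightarrow> fm" where
  "Forall i p = Neg (Exists i (Neg p))"

definition Iff :: "fm \<Rightarrow> fm \<Rightarrow> fm" where
  "Iff p q = Conj (Impl p q) (Impl q p)"

lemma sat_connectives [simp]:
  "sat D v (Impl p q) \<longleftrightarrow> (sat D v p \<longrightarrow> sat D v q)"
  "sat D v (Disj p q) \<longleftrightarrow> sat D v p \<or> sat D v q"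
  "sat D v (Iff p q) \<longleftrightarrow> (sat D v p \<longleftrightarrow> sat D v q)"
  "sat D v (Forall i p) \<longleftrightarrow> (\<forall>x\<in>D. sat D (v(i := x)) p)"
  by (auto simp: Impl_def Disj_def Iff_def Forall_def)

text \<open>The variables from 90 on are reserved for the bound variables of the following formulas.\<close>

definition Subset :: "nat \<Rightarrow> nat \<Rightarrow> fm" where
  "Subset i j = Forall 90 (Impl (Mem 90 i) (Mem 90 j))"

definition Is_opair :: "nat \<Rightarrow> nat \<Rightarrow> nat \<Rightarrow> fm" where
  "Is_opair k i j = Exists 91 (Exists 92 (Conj
     (Forall 93 (Iff (Mem 93 91) (Eq 93 i)))
     (Conj (Forall 93 (Iff (Mem 93 92) (Disj (Eq 93 i) (Eq 93 j))))
     (Forall 93 (Iff (Mem 93 k) (Disj (Eq 93 91) (Eq 93 92)))))))"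

definition Opair_in :: "nat \<Rightarrow> nat \<Rightarrow> nat \<Rightarrow> fm" where
  "Opair_in i j k = Exists 94 (Conj (Is_opair 94 i j) (Mem 94 k))"

definition Opair2_in :: "nat \<Rightarrow> nat \<Rightarrow> nat \<Rightarrow> nat \<Rightarrow> fm" where
  "Opair2_in i j l k = Exists 95 (Conj (Is_opair 95 i j) (Opair_in 95 l k))"

lemma elts_opair: "elts (opair x y) = {hset_of {x}, hset_of {x, y}}"
  and elts_singleton: "elts (hset_of {x}) = {x}"
  and elts_doubleton: "elts (hset_of {x, y}) = {x, y}"
  by (simp_all add: opair_def elts_hset_of finite_small)

text \<open>Transitivity is the property of \<open>H \<chi>\<close> behind the absoluteness of the
  notions coded below: members of its elements are tested inside the class.\<close>

definition transitive_class :: "'k hset set \<Rightarrow> bool" where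
  "transitive_class D \<longleftrightarrow> (\<forall>x\<in>D. elts x \<subseteq> D)"

lemma transitive_class_H: "transitive_class (H \<chi>)"
  unfolding transitive_class_def using H_transitive by blast

lemma transitive_class_opairD:
  assumes D: "transitive_class D" and f: "f \<in> D" "opair x y \<in> elts f"
  shows "x \<in> D" "y \<in> D"
proof -
  have "opair x y \<in> D" using D f unfolding transitive_class_def by blast
  then have "hset_of {x, y} \<in> D" using D elts_opair[of x y] unfolding transitive_class_def by blast
  then show "x \<in> D" "y \<in> D" using D by (auto simp: elts_doubleton transitive_class_def)
qed

lemma transitive_class_quantifiers:
  assumes "transitive_class D" "x \<in> D"
  shows "(\<forall>t\<in>D. t \<in> elts x \<longrightarrow> P t) \<longleftrightarrow> (\<forall>t\<in>elts x. P t)"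
    and "(\<exists>t\<in>D. t \<in> elts x \<and> P t) \<longleftrightarrow> (\<exists>t\<in>elts x. P t)"
  using assms unfolding transitive_class_def by blast+

lemma sat_Subset [simp]:
  assumes "transitive_class D" "v i \<in> D" "i < 90" "j < 90"
  shows "sat D v (Subset i j) \<longleftrightarrow> v i \<le> v j"
  using assms by (auto simp: Subset_def less_eq_hset_def transitive_class_def)

lemma class_ext: "transitive_class D \<Longrightarrow> u \<in> D \<Longrightarrow> w \<in> D \<Longrightarrow> (\<And>t. t \<in> D \<Longrightarrow> t \<in> elts u \<longleftrightarrow> t \<in> elts w) \<Longrightarrow> u = w"
  unfolding transitive_class_def by (intro hset_ext) blast

text \<open>The two witnesses are the members of a Kuratowski pair, so transitivity puts them into
  the class, where testing elements of the class alone determines them.\<close>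

lemma sat_Is_opair [simp]:
  assumes D: "transitive_class D" and v: "v i \<in> D" "v j \<in> D" "v k \<in> D"
    and ij: "i \<notin> {91,92,93}" "j \<notin> {91,92,93}" "k \<notin> {91,92,93}"
  shows "sat D v (Is_opair k i j) \<longleftrightarrow> v k = opair (v i) (v j)"
proof
  assume "sat D v (Is_opair k i j)"
  then obtain u w where uw: "u \<in> D" "w \<in> D" "\<forall>t\<in>D. t \<in> elts u \<longleftrightarrow> t = v i"
    "\<forall>t\<in>D. t \<in> elts w \<longleftrightarrow> t = v i \<or> t = v j" "\<forall>t\<in>D. t \<in> elts (v k) \<longleftrightarrow> t = u \<or> t = w"
    using ij by (auto simp: Is_opair_def)
  have "elts u = {v i}" "elts w = {v i, v j}" and k: "elts (v k) = {u, w}"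
    using uw D v unfolding transitive_class_def by blast+
  then have "u = hset_of {v i}" "w = hset_of {v i, v j}"
    by (simp_all add: hset_ext elts_singleton elts_doubleton)
  then show "v k = opair (v i) (v j)" using k by (simp add: hset_ext elts_opair)
next
  assume *: "v k = opair (v i) (v j)"
  then have "hset_of {v i} \<in> D" "hset_of {v i, v j} \<in> D"
    using D v by (auto simp: elts_opair transitive_class_def)
  moreover have "(\<forall>t\<in>D. t \<in> elts (hset_of {v i}) \<longleftrightarrow> t = v i)"
    "(\<forall>t\<in>D. t \<in> elts (hset_of {v i, v j}) \<longleftrightarrow> t = v i \<or> t = v j)"
    "(\<forall>t\<in>D. t \<in> elts (v k) \<longleftrightarrow> t = hset_of {v i} \<or> t = hset_of {v i, v j})"
    using * by (simp_all add: elts_opair elts_singleton elts_doubleton)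
  ultimately show "sat D v (Is_opair k i j)" using ij
    by (simp add: Is_opair_def) blast
qed

lemma sat_Opair_in [simp]:
  assumes D: "transitive_class D" and v: "v i \<in> D" "v j \<in> D" "v k \<in> D"
    and ij: "i \<notin> {91,92,93,94}" "j \<notin> {91,92,93,94}" "k \<notin> {91,92,93,94}"
  shows "sat D v (Opair_in i j k) \<longleftrightarrow> opair (v i) (v j) \<in> elts (v k)"
  using assms by (auto simp: Opair_in_def transitive_class_def cong: bex_cong)

lemma sat_Opair2_in [simp]:
  assumes D: "transitive_class D" and v: "v i \<in> D" "v j \<in> D" "v l \<in> D" "v k \<in> D"
    and ij: "i < 90" "j < 90" "l < 90" "k < 90"
  shows "sat D v (Opair2_in i j l k) \<longleftrightarrow> opair (opair (v i) (v j)) (v l) \<in> elts (v k)"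
  using transitive_class_opairD[OF D v(4)] assms by (auto simp: Opair2_in_def cong: bex_cong)

definition Single_valued :: "nat \<Rightarrow> fm" where
  "Single_valued k = Forall 96 (Forall 97 (Forall 98 (Impl
     (Conj (Opair_in 96 97 k) (Opair_in 96 98 k)) (Eq 97 98))))"

text \<open>No domain is fixed and members other than pairs are allowed: uniqueness of values is
  what makes \<open>app\<close> compute correctly, and it has a short formula.\<close>

definition single_valued_hset :: "'k hset \<Rightarrow> bool" where
  "single_valued_hset f \<longleftrightarrow> (\<forall>x y z. opair x y \<in> elts f \<longrightarrow> opair x z \<in> elts f \<longrightarrow> y = z)"

lemma sat_Single_valued [simp]:
  assumes "transitive_class D" "v k \<in> D" "k < 90"
  shows "sat D v (Single_valued k) \<longleftrightarrow> single_valued_hset (v k)"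
proof -
  have "sat D v (Single_valued k) \<longleftrightarrow> (\<forall>x\<in>D. \<forall>y\<in>D. \<forall>z\<in>D.
      opair x y \<in> elts (v k) \<and> opair x z \<in> elts (v k) \<longrightarrow> y = z)"
    using assms by (simp add: Single_valued_def cong: ball_cong)
  then show ?thesis
    using transitive_class_opairD[OF assms(1,2)] unfolding single_valued_hset_def by blast
qed

lemma app_eqI: "single_valued_hset f \<Longrightarrow> opair x y \<in> elts f \<Longrightarrow> app f x = y"
  unfolding app_def single_valued_hset_def by blast

lemma prod_setD:
  assumes "f \<in> prod_set A" "a \<in> elts A"
  shows "app f a \<in> elts a" "opair a (app f a) \<in> elts f"
  using assms theI'[of "\<lambda>y. opair a y \<in> elts f"]
  unfolding prod_set_def is_function_on_def app_def by blast+

lemma prod_set_single_valued: "f \<in> prod_set A \<Longrightarrow> single_valued_hset f"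
  unfolding prod_set_def is_function_on_def single_valued_hset_def mem_Collect_eq by (metis opair_inject)

lemma hset_function:
  fixes A :: "'k hset" and F :: "'k hset \<Rightarrow> 'k hset"
  obtains f where "is_function_on f A" "\<And>a. a \<in> elts A \<Longrightarrow> app f a = F a"
proof -
  define f where "f = hset_of ((\<lambda>a. opair a (F a)) ` elts A)"
  have f: "elts f = (\<lambda>a. opair a (F a)) ` elts A"
    unfolding f_def by (rule elts_hset_of[OF small_image]) simp
  have "is_function_on f A" unfolding is_function_on_def f by (auto simp: opair_inject)
  moreover have "app f a = F a" if "a \<in> elts A" for a
    unfolding app_def f using that by (auto simp: opair_inject)
  ultimately show thesis using that by blast
qed

text \<open>One half of the Tarski-Vaught criterion: truth of the existential formula passes down to
  \<open>M\<close>, and truth at the witness found there passes back up to \<open>N\<close>.\<close>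

lemma elem_submodel_witness:
  assumes "elem_submodel M N" "range v \<subseteq> M" "x \<in> N" "sat N (v(i := x)) p"
  obtains y where "y \<in> M" "sat N (v(i := y)) p"
proof -
  have "sat M v (Exists i p)"
    using assms unfolding elem_submodel_def by (metis sat.simps(5))
  then obtain y where y: "y \<in> M" "sat M (v(i := y)) p" by auto
  then have "range (v(i := y)) \<subseteq> M" using assms(2) by auto
  then show thesis using assms(1) y that unfolding elem_submodel_def by blast
qed

text \<open>Variable 0 is the element and variable 1, which must not matter, stands for the set itself.\<close>

lemma elem_submodel_definable:
  assumes "elem_submodel M N" "transitive_class N" "range v \<subseteq> M" "X \<in> N"
    and p: "\<And>y z. y \<in> N \<Longrightarrow> z \<in> N \<Longrightarrow> sat N (v(1 := z, 0 := y)) p \<longleftrightarrow> y \<in> elts X"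
  shows "X \<in> M"
proof -
  \<comment> \<open>The formula says that variable 1 has exactly the members defined by
    \<open>p\<close>. By extensionality its only solution in \<open>N\<close> is \<open>X\<close>,
    so the witness taken from \<open>M\<close> is \<open>X\<close>.\<close>
  have "sat N (v(1 := X)) (Forall 0 (Iff (Mem 0 1) p))"
    using p assms(4) by simp
  then obtain z where z: "z \<in> M" "sat N (v(1 := z)) (Forall 0 (Iff (Mem 0 1) p))"
    using elem_submodel_witness[OF assms(1,3,4)] by metis
  have zN: "z \<in> N" using z(1) assms(1) by (auto simp: elem_submodel_def)
  then have "\<And>t. t \<in> N \<Longrightarrow> t \<in> elts z \<longleftrightarrow> t \<in> elts X" using z(2) p by simp
  then have "z = X" by (rule class_ext[OF assms(2) zN assms(4)])
  then show ?thesis using z by simp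
qed

section \<open>Ladder systems and the covering argument\<close>

locale elementary_covering =
  fixes \<sigma> \<theta> \<mu> \<chi> :: "'k hset" and M :: "'k hset set"
  assumes \<sigma>_Reg: "\<sigma> \<in> Reg" and \<theta>_Reg: "\<theta> \<in> Reg" and \<mu>_Card: "Card \<mu>"
    and aleph0_less: "aleph0 < \<sigma>" and cf_less: "cf \<mu> < \<theta>" and \<theta>_less: "\<theta> < \<mu>"
    and \<chi>_Reg: "\<chi> \<in> Reg" and \<mu>_less: "\<mu> < \<chi>"
    and elem: "elem_submodel M (H \<chi>)" and succ_subset: "elts (succ \<mu>) \<subseteq> M"
    and cofinal: "\<And>A. A \<in> M \<Longrightarrow> elts A \<subseteq> elts \<mu> \<inter> Reg \<Longrightarrow> |elts A| <o |elts \<mu>| \<Longrightarrow>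
      cofinal_mod_bounded \<theta> \<sigma> \<mu> (M \<inter> prod_set A) A"
begin

lemma Ord_\<mu>: "Ord \<mu>" using \<mu>_Card by (simp add: Card_def)

lemma Ord_\<theta>: "Ord \<theta>" using \<theta>_Reg by (rule Reg_Ord)

lemma \<theta>_in_\<mu>: "\<theta> \<in> elts \<mu>" using \<theta>_less Ord_less_iff[OF Ord_\<theta> Ord_\<mu>] by simp

lemma \<mu>_in_\<chi>: "\<mu> \<in> elts \<chi>" using \<mu>_less Ord_less_iff[OF Ord_\<mu> Reg_Ord[OF \<chi>_Reg]] by simp

lemma cf_in_\<theta>: "cf \<mu> \<in> elts \<theta>" using cf_less Ord_less_iff[OF Ord_cf[OF Ord_\<mu>] Ord_\<theta>] by simp

lemma infinite_\<mu>: "infinite (elts \<mu>)"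
  using \<theta>_Reg \<theta>_less unfolding Reg_def less_hset_def by (auto dest: finite_subset)

lemma card_\<mu>_less: "|elts \<mu>| <o |elts \<chi>|"
  using \<chi>_Reg \<mu>_in_\<chi> by (simp add: Reg_def Card_def)

lemma \<mu>_in_M: "\<mu> \<in> M" and mem_\<mu>_in_M: "\<alpha> \<in> elts \<mu> \<Longrightarrow> \<alpha> \<in> M"
  using succ_subset by (auto simp: elts_succ)

lemma M_in_H: "x \<in> M \<Longrightarrow> x \<in> H \<chi>"
  using elem by (auto simp: elem_submodel_def)

lemma mem_M_in_H: "x \<in> M \<Longrightarrow> y \<in> elts x \<Longrightarrow> y \<in> H \<chi>"
  using M_in_H H_transitive by blast

lemma elts_subset_\<mu>: "X \<subseteq> elts \<mu> \<Longrightarrow> elts (hset_of X) = X"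
  by (rule elts_hset_of[OF small_subset])

text \<open>Subsets of \<mu> have size below \<chi> and members in \<open>H \<chi>\<close>, so they
  lie in \<open>H \<chi>\<close>; definability with parameters from \<open>M\<close> then
  suffices.\<close>

lemma subset_\<mu>_in_M:
  assumes "range v \<subseteq> M" "X \<subseteq> elts \<mu>"
    and p: "\<And>y z. y \<in> H \<chi> \<Longrightarrow> z \<in> H \<chi> \<Longrightarrow> sat (H \<chi>) (v(1 := z, 0 := y)) p \<longleftrightarrow> y \<in> X"
  shows "hset_of X \<in> M"
proof (rule elem_submodel_definable[OF elem transitive_class_H assms(1)])
  have "|X| <o |elts \<chi>|" using ordLeq_ordLess_trans[OF card_of_mono1[OF assms(2)] card_\<mu>_less] .
  then show "hset_of X \<in> H \<chi>"
    using assms(2) mem_\<mu>_in_M M_in_H by (intro hset_of_in_H[OF \<chi>_Reg]) blast+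
  show "sat (H \<chi>) (v(1 := z, 0 := y)) p \<longleftrightarrow> y \<in> elts (hset_of X)"
    if "y \<in> H \<chi>" "z \<in> H \<chi>" for y z
    using p that assms(2) by (simp add: elts_subset_\<mu>)
qed

section \<open>The set of regular cardinals between \<theta> and \<mu> belongs to the
  submodel\<close>

definition regulars :: "'k hset set" where
  "regulars = {b \<in> elts \<mu>. b \<in> Reg \<and> b \<notin> elts \<theta>}"

lemma not_in_\<theta>D: "b \<in> elts \<mu> \<Longrightarrow> b \<notin> elts \<theta> \<Longrightarrow> \<theta> \<le> b"
  using Ord_not_le_iff[of \<theta> b] Ord_\<theta> Ord_in_Ord[OF Ord_\<mu>] by blast

text \<open>Regularity is expressed by boundedness of partial maps from smaller ordinals, with maps
  taken from \<open>H \<chi>\<close> only. This loses nothing: if \<open>cf y\<close> were below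
  \<open>y\<close>, the graph of a cofinal map would be a counterexample in
  \<open>H \<chi>\<close>.\<close>

lemma Reg_iff_in_H:
  assumes y: "y \<in> elts \<mu>" "y \<notin> elts \<theta>"
  shows "y \<in> Reg \<longleftrightarrow> (\<forall>b\<in>elts y. \<forall>h\<in>H \<chi>. single_valued_hset h \<longrightarrow>
    (\<exists>\<gamma>\<in>elts y. \<forall>\<xi>\<in>elts b. \<forall>\<delta>\<in>elts y. opair \<xi> \<delta> \<in> elts h \<longrightarrow> \<delta> \<in> elts \<gamma>))" (is "_ \<longleftrightarrow> ?rhs")
proof
  assume reg: "y \<in> Reg"
  show ?rhs
  proof (intro ballI impI)
    fix b h :: "'k hset" assume b: "b \<in> elts y" and h: "single_valued_hset h"
    define X where "X = {\<delta> \<in> elts y. \<exists>\<xi>\<in>elts b. opair \<xi> \<delta> \<in> elts h}"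
    define F where "F \<xi> = (SOME \<delta>. opair \<xi> \<delta> \<in> elts h)" for \<xi>
    have "\<delta> = F \<xi>" if "opair \<xi> \<delta> \<in> elts h" for \<xi> \<delta>
      using someI[of "\<lambda>\<delta>. opair \<xi> \<delta> \<in> elts h", OF that] that h unfolding F_def single_valued_hset_def by blast
    then have "X \<subseteq> F ` elts b" unfolding X_def by blast
    then have "|X| \<le>o |elts b|" using card_of_mono1 card_of_image ordLeq_transitive by blast
    moreover have "|elts b| <o |elts y|" using reg b by (simp add: Reg_def Card_def)
    ultimately have "|X| <o |elts y|" by (rule ordLeq_ordLess_trans)
    then obtain \<gamma> where "\<gamma> \<in> elts y" "X \<subseteq> elts \<gamma>"
      using Reg_bounded[OF reg, of X] unfolding X_def by blast
    then show "\<exists>\<gamma>\<in>elts y. \<forall>\<xi>\<in>elts b. \<forall>\<delta>\<in>elts y. opair \<xi> \<delta> \<in> elts h \<longrightarrow> \<delta> \<in> elts \<gamma>"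
      unfolding X_def by blast
  qed
next
  assume R: ?rhs
  have oy: "Ord y" using Ord_in_Ord[OF Ord_\<mu> y(1)] .
  have y\<chi>: "y \<in> elts \<chi>" using Ord_Transset[OF Reg_Ord[OF \<chi>_Reg] \<mu>_in_\<chi> y(1)] .
  have "cf y \<notin> elts y"
  proof
    assume b: "cf y \<in> elts y"
    obtain f where f: "cofinal_map f (cf y) y" using cf_cofinal[OF oy] by blast
    define G where "G = (\<lambda>\<xi>. opair \<xi> (f \<xi>)) ` elts (cf y)"
    have "|elts (cf y)| <o |elts \<chi>|"
      using \<chi>_Reg Ord_Transset[OF Reg_Ord[OF \<chi>_Reg] y\<chi> b] by (simp add: Reg_def Card_def)
    then have G: "|G| <o |elts \<chi>|"
      unfolding G_def by (rule ordLeq_ordLess_trans[OF card_of_image])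
    have yH: "x \<in> H \<chi>" if "x \<in> elts y" for x
      using mem_M_in_H[OF mem_\<mu>_in_M[OF y(1)] that] .
    have bH: "x \<in> H \<chi>" if "x \<in> elts (cf y)" for x
      using yH[OF Ord_Transset[OF oy b that]] .
    have "G \<subseteq> H \<chi>"
      using f bH yH unfolding G_def cofinal_map_def by (auto intro!: opair_in_H[OF \<chi>_Reg])
    then have hH: "hset_of G \<in> H \<chi>" using hset_of_in_H[OF \<chi>_Reg] G by blast
    have h: "elts (hset_of G) = G" by (rule elts_hset_of[OF small_if_card_less[OF G]])
    have "single_valued_hset (hset_of G)"
      unfolding single_valued_hset_def h by (auto simp: G_def opair_inject)
    then obtain \<gamma> where \<gamma>: "\<gamma> \<in> elts y" "\<forall>\<xi>\<in>elts (cf y). \<forall>\<delta>\<in>elts y. opair \<xi> \<delta> \<in> G \<longrightarrow> \<delta> \<in> elts \<gamma>"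
      using R b hH h by metis
    obtain \<xi> where \<xi>: "\<xi> \<in> elts (cf y)" "\<gamma> \<le> f \<xi>" using f \<gamma>(1) unfolding cofinal_map_def by blast
    then have "f \<xi> \<in> elts \<gamma>" using \<gamma>(2) f unfolding cofinal_map_def G_def by blast
    then show False using \<xi>(2) mem_irrefl[of "f \<xi>"] by (auto simp: less_eq_hset_def)
  qed
  then have "cf y = y" using Ord_le_cases[OF oy Ord_cf[OF oy] cf_le_self[OF oy]] by blast
  \<comment> \<open>The formula does not express infinity; it comes from \<open>y\<close> not being
    below \<theta>.\<close>
  moreover have "infinite (elts y)"
    using not_in_\<theta>D[OF y] \<theta>_Reg by (auto simp: less_eq_hset_def Reg_def dest: finite_subset)
  ultimately show "y \<in> Reg" using Card_cf[OF oy] by (simp add: Reg_def)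
qed

lemma regulars_in_M: "hset_of regulars \<in> M"
proof -
  \<comment> \<open>Variable 2 keeps the default value \<mu>; variables 4 to 8 play the roles of
    \<open>b\<close>, \<open>h\<close>, \<gamma>, \<xi>, \<delta> in
    \<open>Reg_iff_in_H\<close>.\<close>
  define v where "v = (\<lambda>_::nat. \<mu>)(3 := \<theta>)"
  define p where "p = Conj (Mem 0 2) (Conj (Neg (Mem 0 3)) (Forall 4 (Impl (Mem 4 0)
    (Forall 5 (Impl (Single_valued 5) (Exists 6 (Conj (Mem 6 0) (Forall 7 (Impl (Mem 7 4)
      (Forall 8 (Impl (Mem 8 0) (Impl (Opair_in 7 8 5) (Mem 8 6)))))))))))))"
  have v: "range v \<subseteq> M" using \<mu>_in_M mem_\<mu>_in_M[OF \<theta>_in_\<mu>] by (auto simp: v_def)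
  show ?thesis
  proof (rule subset_\<mu>_in_M[OF v, where p = p])
    show "regulars \<subseteq> elts \<mu>" by (auto simp: regulars_def)
    fix y z assume yz: "y \<in> H \<chi>" "z \<in> H \<chi>"
    have "sat (H \<chi>) (v(1 := z, 0 := y)) p \<longleftrightarrow> y \<in> elts \<mu> \<and> y \<notin> elts \<theta> \<and>
      (\<forall>b\<in>elts y. \<forall>h\<in>H \<chi>. single_valued_hset h \<longrightarrow>
        (\<exists>\<gamma>\<in>elts y. \<forall>\<xi>\<in>elts b. \<forall>\<delta>\<in>elts y. opair \<xi> \<delta> \<in> elts h \<longrightarrow> \<delta> \<in> elts \<gamma>))"
      by (simp add: p_def v_def transitive_class_H transitive_class_quantifiers yz cong: ball_cong bex_cong)
    also have "\<dots> \<longleftrightarrow> y \<in> regulars" using Reg_iff_in_H unfolding regulars_def by blast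
    finally show "sat (H \<chi>) (v(1 := z, 0 := y)) p \<longleftrightarrow> y \<in> regulars" .
  qed
qed


section \<open>Ladder systems\<close>

lemma succ_\<mu>D:
  assumes "\<beta> \<in> elts (succ \<mu>)"
  shows "\<beta> \<in> M" "Ord \<beta>" "\<gamma> \<in> elts \<beta> \<Longrightarrow> \<gamma> \<in> elts \<mu>"
  using assms succ_subset Ord_\<mu> Ord_in_Ord[OF Ord_\<mu>] Ord_Transset[OF Ord_\<mu>] by (auto simp: elts_succ)

lemma cf_in_\<mu>:
  assumes "\<beta> \<in> elts (succ \<mu>)"
  shows "cf \<beta> \<in> elts \<mu>"
proof (cases "\<beta> = \<mu>")
  case True
  then show ?thesis using Ord_Transset[OF Ord_\<mu> \<theta>_in_\<mu> cf_in_\<theta>] by simp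
next
  case False
  then have "\<beta> \<in> elts \<mu>" using assms by (simp add: elts_succ)
  then show ?thesis
    using Ord_le_mem_trans[OF Ord_\<mu>] Ord_cf cf_le_self succ_\<mu>D(2)[OF assms] by blast
qed

text \<open>The triple \<open>((\<beta>, \<xi>), \<gamma>)\<close> in \<open>E\<close> means \<open>e\<^sub>\<beta>(\<xi>) = \<gamma>\<close>.\<close>

definition ladder :: "'k hset \<Rightarrow> 'k hset \<Rightarrow> 'k hset \<Rightarrow> bool" where
  "ladder E \<beta> b \<longleftrightarrow> (\<forall>\<alpha>\<in>elts \<beta>. \<exists>\<xi>0\<in>elts b. \<forall>\<xi>\<in>elts b. \<xi>0 \<le> \<xi> \<longrightarrow>
    (\<exists>\<gamma>\<in>elts \<beta>. \<alpha> \<le> \<gamma> \<and> opair (opair \<beta> \<xi>) \<gamma> \<in> elts E))"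

text \<open>The value \<open>b\<close> stands for \<open>cf \<beta>\<close>, but only the properties
  used later are demanded; this spares expressing cofinality by a formula.\<close>

definition ladder_system :: "'k hset \<Rightarrow> 'k hset \<Rightarrow> bool" where
  "ladder_system c E \<longleftrightarrow> single_valued_hset c \<and> single_valued_hset E \<and>
    (\<forall>\<beta>\<in>elts (succ \<mu>). \<exists>b. opair \<beta> b \<in> elts c \<and> (b \<in> regulars \<or> b \<in> elts \<theta>) \<and>
      ladder E \<beta> b)"

text \<open>The graphs of \<open>cf\<close> and of the maps from \<open>tail_cofinal_map\<close>
  have fewer than \<chi> members, all built by pairing from elements of
  \<open>H \<chi>\<close>.\<close>

lemma ladder_system_in_H: "\<exists>c\<in>H \<chi>. \<exists>E\<in>H \<chi>. ladder_system c E"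
proof -
  have "\<forall>\<beta>\<in>elts (succ \<mu>). \<exists>e. e ` elts (cf \<beta>) \<subseteq> elts \<beta> \<and>
    (\<forall>\<gamma>\<in>elts \<beta>. \<exists>\<xi>0\<in>elts (cf \<beta>). \<forall>\<xi>\<in>elts (cf \<beta>). \<xi>0 \<le> \<xi> \<longrightarrow> \<gamma> \<le> e \<xi>)"
    using tail_cofinal_map[OF succ_\<mu>D(2)] by metis
  then obtain e where e: "\<And>\<beta>. \<beta> \<in> elts (succ \<mu>) \<Longrightarrow> e \<beta> ` elts (cf \<beta>) \<subseteq> elts \<beta> \<and>
    (\<forall>\<gamma>\<in>elts \<beta>. \<exists>\<xi>0\<in>elts (cf \<beta>). \<forall>\<xi>\<in>elts (cf \<beta>). \<xi>0 \<le> \<xi> \<longrightarrow> \<gamma> \<le> e \<beta> \<xi>)"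
    using bchoice[of "elts (succ \<mu>)"] by metis
  define C where "C = (\<lambda>\<beta>. opair \<beta> (cf \<beta>)) ` elts (succ \<mu>)"
  define L where "L = (\<Union>\<beta>\<in>elts (succ \<mu>). (\<lambda>\<xi>. opair (opair \<beta> \<xi>) (e \<beta> \<xi>)) ` elts (cf \<beta>))"
  have succ_H: "\<beta> \<in> H \<chi>" if "\<beta> \<in> elts (succ \<mu>)" for \<beta> using M_in_H succ_\<mu>D(1)[OF that] .
  have \<mu>_H: "\<beta> \<in> H \<chi>" if "\<beta> \<in> elts \<mu>" for \<beta> using M_in_H mem_\<mu>_in_M[OF that] .
  have inf: "infinite (elts \<chi>)" using \<chi>_Reg by (simp add: Reg_def)
  have card_succ: "|elts (succ \<mu>)| <o |elts \<chi>|"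
    using card_of_Un_ordLess_infinite[OF inf finite_card_less[OF \<chi>_Reg, of "{\<mu>}"] card_\<mu>_less]
    by (simp add: elts_succ)
  have card_cf: "|elts (cf \<beta>)| <o |elts \<chi>|" if "\<beta> \<in> elts (succ \<mu>)" for \<beta>
    using \<chi>_Reg Ord_Transset[OF Reg_Ord[OF \<chi>_Reg] \<mu>_in_\<chi> cf_in_\<mu>[OF that]] by (simp add: Reg_def Card_def)
  have cardC: "|C| <o |elts \<chi>|"
    unfolding C_def by (rule ordLeq_ordLess_trans[OF card_of_image card_succ])
  have cardL: "|L| <o |elts \<chi>|"
    unfolding L_def by (rule Reg_UNION[OF \<chi>_Reg card_succ ordLeq_ordLess_trans[OF card_of_image card_cf]])
  have "C \<subseteq> H \<chi>"
    unfolding C_def using cf_in_\<mu> succ_H \<mu>_H by (auto intro!: opair_in_H[OF \<chi>_Reg])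
  then have CH: "hset_of C \<in> H \<chi>" by (rule hset_of_in_H[OF \<chi>_Reg _ cardC])
  have "opair (opair \<beta> \<xi>) (e \<beta> \<xi>) \<in> H \<chi>" if \<beta>: "\<beta> \<in> elts (succ \<mu>)" and \<xi>: "\<xi> \<in> elts (cf \<beta>)" for \<beta> \<xi>
  proof -
    have "e \<beta> \<xi> \<in> elts \<mu>" using e[OF \<beta>] \<xi> succ_\<mu>D(3)[OF \<beta>] by blast
    moreover have "\<xi> \<in> elts \<mu>" using Ord_Transset[OF Ord_\<mu> cf_in_\<mu>[OF \<beta>] \<xi>] .
    ultimately show ?thesis using \<mu>_H succ_H[OF \<beta>] by (intro opair_in_H[OF \<chi>_Reg])
  qed
  then have "L \<subseteq> H \<chi>" unfolding L_def by blast
  then have LH: "hset_of L \<in> H \<chi>" by (rule hset_of_in_H[OF \<chi>_Reg _ cardL])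
  have C: "elts (hset_of C) = C" by (rule elts_hset_of[OF small_if_card_less[OF cardC]])
  have L: "elts (hset_of L) = L" by (rule elts_hset_of[OF small_if_card_less[OF cardL]])
  have "ladder_system (hset_of C) (hset_of L)"
    unfolding ladder_system_def C L
  proof (intro conjI ballI)
    show "single_valued_hset (hset_of C)" "single_valued_hset (hset_of L)"
      unfolding single_valued_hset_def C L by (auto simp: C_def L_def opair_inject)
    fix \<beta> assume \<beta>: "\<beta> \<in> elts (succ \<mu>)"
    have "opair \<beta> (cf \<beta>) \<in> C" unfolding C_def using \<beta> by blast
    \<comment> \<open>Zero and successor ordinals have finite cofinality and fall under the second
      alternative; a cofinality of at least \<theta> is infinite, hence regular.\<close>
    moreover have "cf \<beta> \<in> regulars \<or> cf \<beta> \<in> elts \<theta>"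
    proof (cases "cf \<beta> \<in> elts \<theta>")
      case False
      then have "\<theta> \<le> cf \<beta>" using not_in_\<theta>D cf_in_\<mu>[OF \<beta>] by blast
      then have "infinite (elts (cf \<beta>))"
        using \<theta>_Reg by (auto simp: less_eq_hset_def Reg_def dest: finite_subset)
      then show ?thesis
        using cf_in_Reg[OF succ_\<mu>D(2)[OF \<beta>]] False cf_in_\<mu>[OF \<beta>] by (simp add: regulars_def)
    qed simp
    moreover have "ladder (hset_of L) \<beta> (cf \<beta>)"
      unfolding ladder_def L
    proof
      fix \<alpha> assume "\<alpha> \<in> elts \<beta>"
      obtain \<xi>0 where "\<xi>0 \<in> elts (cf \<beta>)" "\<forall>\<xi>\<in>elts (cf \<beta>). \<xi>0 \<le> \<xi> \<longrightarrow> \<alpha> \<le> e \<beta> \<xi>"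
        using e[OF \<beta>] \<open>\<alpha> \<in> elts \<beta>\<close> by blast
      moreover have "e \<beta> \<xi> \<in> elts \<beta> \<and> opair (opair \<beta> \<xi>) (e \<beta> \<xi>) \<in> L" if "\<xi> \<in> elts (cf \<beta>)" for \<xi>
        using e[OF \<beta>] that \<beta> unfolding L_def by blast
      ultimately show "\<exists>\<xi>0\<in>elts (cf \<beta>). \<forall>\<xi>\<in>elts (cf \<beta>). \<xi>0 \<le> \<xi> \<longrightarrow>
        (\<exists>\<gamma>\<in>elts \<beta>. \<alpha> \<le> \<gamma> \<and> opair (opair \<beta> \<xi>) \<gamma> \<in> L)" by blast
    qed
    ultimately show "\<exists>b. opair \<beta> b \<in> C \<and> (b \<in> regulars \<or> b \<in> elts \<theta>) \<and> ladder (hset_of L) \<beta> b" by blast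
  qed
  then show ?thesis using CH LH by blast
qed

text \<open>Being a ladder system is first-order over \<open>H \<chi>\<close> in the parameters
  \<mu>, \<theta> and \<open>regulars\<close>, so elementarity moves a solution into
  \<open>M\<close>.\<close>

lemma ladder_system_in_M: "\<exists>c\<in>M. \<exists>E\<in>M. ladder_system c E"
proof -
  define v where "v = (\<lambda>_::nat. \<mu>)(3 := \<theta>, 4 := hset_of regulars)"
  \<comment> \<open>Variables 5 and 6 are \<open>c\<close> and \<open>E\<close>; 7 to 12 are
    \<beta>, \<open>b\<close>, \<alpha>, \<open>\<xi>0\<close>, \<xi>, \<gamma>. The disjunction
    \<open>Disj (Eq 7 2) (Mem 7 2)\<close> expresses membership in
    \<open>succ \<mu>\<close>.\<close>
  define p where "p = Conj (Single_valued 5) (Conj (Single_valued 6)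
    (Forall 7 (Impl (Disj (Eq 7 2) (Mem 7 2)) (Exists 8 (Conj (Opair_in 7 8 5) (Conj (Disj (Mem 8 4) (Mem 8 3))
      (Forall 9 (Impl (Mem 9 7) (Exists 10 (Conj (Mem 10 8) (Forall 11 (Impl (Mem 11 8) (Impl (Subset 10 11)
        (Exists 12 (Conj (Mem 12 7) (Conj (Subset 9 12) (Opair2_in 7 11 12 6)))))))))))))))))"
  have v: "range v \<subseteq> M"
    using \<mu>_in_M mem_\<mu>_in_M[OF \<theta>_in_\<mu>] regulars_in_M by (auto simp: v_def)
  have reg: "elts (hset_of regulars) = regulars"
    by (rule elts_subset_\<mu>) (auto simp: regulars_def)
  have p: "sat (H \<chi>) (v(5 := c, 6 := E)) p \<longleftrightarrow> ladder_system c E" if "c \<in> H \<chi>" "E \<in> H \<chi>" for c E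
  proof -
    have "sat (H \<chi>) (v(5 := c, 6 := E)) p \<longleftrightarrow> single_valued_hset c \<and> single_valued_hset E \<and>
    (\<forall>\<beta>\<in>H \<chi>. \<beta> = \<mu> \<or> \<beta> \<in> elts \<mu> \<longrightarrow> (\<exists>b\<in>H \<chi>. opair \<beta> b \<in> elts c \<and> (b \<in> regulars \<or> b \<in> elts \<theta>) \<and> ladder E \<beta> b))"
      using that reg
      by (simp add: ladder_def p_def v_def transitive_class_H transitive_class_quantifiers cong: ball_cong bex_cong)
    also have "\<dots> \<longleftrightarrow> ladder_system c E"
    proof -
      have "\<beta> \<in> H \<chi>" if "\<beta> \<in> elts (succ \<mu>)" for \<beta> using M_in_H succ_\<mu>D(1)[OF that] .
      moreover have "b \<in> H \<chi>" if "opair \<beta> b \<in> elts c" for \<beta> b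
        using transitive_class_opairD[OF transitive_class_H \<open>c \<in> H \<chi>\<close> that] by blast
      ultimately show ?thesis unfolding ladder_system_def elts_succ by blast
    qed
    finally show ?thesis .
  qed
  obtain c0 E0 where c0: "c0 \<in> H \<chi>" "E0 \<in> H \<chi>" "ladder_system c0 E0"
    using ladder_system_in_H by blast
  then have "sat (H \<chi>) (v(5 := c0)) (Exists 6 p)" using p by auto
  then obtain c where c: "c \<in> M" "sat (H \<chi>) (v(5 := c)) (Exists 6 p)"
    using elem_submodel_witness[OF elem v c0(1)] by metis
  \<comment> \<open>\<open>E0\<close> was chosen for \<open>c0\<close> and need not fit
    \<open>c\<close>. The new partner \<open>E1\<close> is only known to lie in
    \<open>H \<chi>\<close>; a second use of elementarity replaces it by a member of
    \<open>M\<close>.\<close>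
  then obtain E1 where E1: "E1 \<in> H \<chi>" "sat (H \<chi>) (v(5 := c, 6 := E1)) p" by auto
  have "range (v(5 := c)) \<subseteq> M" using v c(1) by auto
  then obtain E where "E \<in> M" "sat (H \<chi>) (v(5 := c, 6 := E)) p"
    using elem_submodel_witness[OF elem _ E1] by metis
  then show ?thesis using p c(1) M_in_H by blast
qed


section \<open>One refinement step\<close>

definition refines :: "'k hset set \<Rightarrow> 'k hset \<Rightarrow> 'k hset set \<Rightarrow> bool" where
  "refines x N S \<longleftrightarrow> (\<forall>\<alpha>\<in>x. \<forall>\<beta>\<in>elts N. \<alpha> \<in> elts \<beta> \<longrightarrow> (\<forall>\<beta>'\<in>elts N. \<alpha> \<le> \<beta>' \<longrightarrow> \<beta> \<le> \<beta>') \<longrightarrow>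
    (\<exists>N'\<in>S. \<exists>\<gamma>\<in>elts N'. \<alpha> \<le> \<gamma> \<and> \<gamma> \<in> elts \<beta>))"

text \<open>Ladder indices below a common bound \<open>Z\<close> in \<mu> are all taken into one
  set. For values of \<open>c\<close> not below \<open>Z\<close>, the cofinality hypothesis supplies
  functions in \<open>M\<close> that overshoot the needed indices.\<close>

lemma refinement_step:
  assumes cE: "c \<in> M" "E \<in> M" "ladder_system c E"
    and N: "N \<in> M" "elts N \<subseteq> elts (succ \<mu>)" "|elts N| <o |elts \<mu>|"
    and x: "|x| <o |elts \<theta>|"
  obtains S where "S \<subseteq> M \<inter> subsets_lt \<mu> \<mu>" "|S| <o |elts \<sigma>|" "refines x N S"
proof -
  have sv: "single_valued_hset c" "single_valued_hset E" using cE(3) by (auto simp: ladder_system_def)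
  have ladder: "opair \<beta> (app c \<beta>) \<in> elts c" "app c \<beta> \<in> regulars \<or> app c \<beta> \<in> elts \<theta>"
    "ladder E \<beta> (app c \<beta>)" if \<beta>: "\<beta> \<in> elts N" for \<beta>
  proof -
    obtain b where b: "opair \<beta> b \<in> elts c" "b \<in> regulars \<or> b \<in> elts \<theta>" "ladder E \<beta> b"
      using cE(3) subsetD[OF N(2) \<beta>] unfolding ladder_system_def by blast
    then have "app c \<beta> = b" using app_eqI[OF sv(1)] by blast
    then show "opair \<beta> (app c \<beta>) \<in> elts c" "app c \<beta> \<in> regulars \<or> app c \<beta> \<in> elts \<theta>"
      "ladder E \<beta> (app c \<beta>)" using b by auto
  qed
  have "\<exists>i. \<forall>\<beta>\<in>elts N. \<forall>\<alpha>\<in>elts \<beta>. i \<beta> \<alpha> \<in> elts (app c \<beta>) \<and> (\<forall>\<xi>\<in>elts (app c \<beta>). i \<beta> \<alpha> \<le> \<xi> \<longrightarrow>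
        (\<exists>\<gamma>\<in>elts \<beta>. \<alpha> \<le> \<gamma> \<and> opair (opair \<beta> \<xi>) \<gamma> \<in> elts E))"
    using ladder(3) unfolding ladder_def by metis
  then obtain i where i: "\<And>\<beta> \<alpha>. \<beta> \<in> elts N \<Longrightarrow> \<alpha> \<in> elts \<beta> \<Longrightarrow> i \<beta> \<alpha> \<in> elts (app c \<beta>)"
    and tail: "\<And>\<beta> \<alpha> \<xi>. \<beta> \<in> elts N \<Longrightarrow> \<alpha> \<in> elts \<beta> \<Longrightarrow> \<xi> \<in> elts (app c \<beta>) \<Longrightarrow> i \<beta> \<alpha> \<le> \<xi> \<Longrightarrow>
        \<exists>\<gamma>\<in>elts \<beta>. \<alpha> \<le> \<gamma> \<and> opair (opair \<beta> \<xi>) \<gamma> \<in> elts E"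
    by blast
  have app_c_\<mu>: "app c \<beta> \<in> elts \<mu>" if "\<beta> \<in> elts N" for \<beta>
    using ladder(2)[OF that] Ord_Transset[OF Ord_\<mu> \<theta>_in_\<mu>] by (auto simp: regulars_def)

  \<comment> \<open>The index set for the cofinality hypothesis: definable from \<open>c\<close>,
    \<open>N\<close> and \<open>regulars\<close>, hence in \<open>M\<close>, and with at most as
    many members as \<open>N\<close>.\<close>
  define A where "A = {b \<in> regulars. \<exists>\<beta>\<in>elts N. opair \<beta> b \<in> elts c}"
  have A_sub: "A \<subseteq> elts \<mu>" "A \<subseteq> Reg" by (auto simp: A_def regulars_def)
  have elts_A: "elts (hset_of A) = A" by (rule elts_subset_\<mu>[OF A_sub(1)])
  have A_M: "hset_of A \<in> M"
  proof -
    define v where "v = (\<lambda>_::nat. c)(2 := hset_of regulars, 3 := N)"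
    have v: "range v \<subseteq> M" using cE N(1) regulars_in_M by (auto simp: v_def)
    have reg: "elts (hset_of regulars) = regulars"
      by (rule elts_subset_\<mu>) (auto simp: regulars_def)
    show ?thesis
    proof (rule subset_\<mu>_in_M[OF v A_sub(1), where p = "Conj (Mem 0 2) (Exists 5 (Conj (Mem 5 3) (Opair_in 5 0 4)))"])
      fix y z assume "y \<in> H \<chi>" "z \<in> H \<chi>"
      then show "sat (H \<chi>) (v(1 := z, 0 := y)) (Conj (Mem 0 2) (Exists 5 (Conj (Mem 5 3) (Opair_in 5 0 4)))) \<longleftrightarrow> y \<in> A"
        using M_in_H cE(1) N(1)
        by (simp add: A_def v_def reg transitive_class_H transitive_class_quantifiers cong: ball_cong bex_cong)
    qed
  qed
  have "A \<subseteq> app c ` elts N" unfolding A_def using app_eqI[OF sv(1)] by blast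
  then have "|A| <o |elts \<mu>|"
    using card_of_mono1 card_of_image ordLeq_transitive ordLeq_ordLess_trans N(3) by metis
  then have cof: "cofinal_mod_bounded \<theta> \<sigma> \<mu> (M \<inter> prod_set (hset_of A)) (hset_of A)"
    using cofinal[OF A_M] A_sub by (simp add: elts_A)

  \<comment> \<open>The graph of the partial map that sends \<alpha> to the least element of
    \<open>N\<close> above it; any \<alpha> already in \<open>N\<close> is left out.\<close>
  define T where "T = {(\<alpha>, \<beta>). \<alpha> \<in> x \<and> \<beta> \<in> elts N \<and> \<alpha> \<in> elts \<beta> \<and> (\<forall>\<beta>'\<in>elts N. \<alpha> \<le> \<beta>' \<longrightarrow> \<beta> \<le> \<beta>')}"
  have T_unique: "\<beta> = \<beta>'" if "(\<alpha>, \<beta>) \<in> T" "(\<alpha>, \<beta>') \<in> T" for \<alpha> \<beta> \<beta>'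
  proof -
    have "Ord \<beta>" "Ord \<beta>'" using that N(2) succ_\<mu>D(2) unfolding T_def by blast+
    then have "\<alpha> \<le> \<beta>" "\<alpha> \<le> \<beta>'" using that Ord_mem_imp_le unfolding T_def by blast+
    then show ?thesis using that unfolding T_def by (auto intro: antisym)
  qed
  define t where "t \<alpha> = (THE \<beta>. (\<alpha>, \<beta>) \<in> T)" for \<alpha>
  have t: "t \<alpha> = \<beta>" if "(\<alpha>, \<beta>) \<in> T" for \<alpha> \<beta>
    unfolding t_def using that T_unique by blast
  have T_x: "\<alpha> \<in> x" "\<beta> \<in> elts N" "\<alpha> \<in> elts \<beta>" if "(\<alpha>, \<beta>) \<in> T" for \<alpha> \<beta> using that by (auto simp: T_def)
  have card_x: "|f ` x| <o |elts \<theta>|" for f :: "'k hset \<Rightarrow> 'k hset"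
    by (rule ordLeq_ordLess_trans[OF card_of_image x])

  \<comment> \<open>\<open>B\<close> depends on \<open>x\<close> and may lie outside
    \<open>M\<close>; the cofinality hypothesis asks membership in \<open>M\<close> only of the
    larger set \<open>A\<close>.\<close>
  define B where "B = {b \<in> A. \<exists>(\<alpha>, \<beta>)\<in>T. b = app c \<beta>}"
  have B_A: "B \<subseteq> A" by (auto simp: B_def)
  have elts_B: "elts (hset_of B) = B" using B_A A_sub(1) by (intro elts_subset_\<mu>) blast
  have "B \<subseteq> (\<lambda>\<alpha>. app c (t \<alpha>)) ` x" unfolding B_def using t T_x(1) by blast
  then have card_B: "|B| <o |elts \<theta>|" by (rule ordLeq_ordLess_trans[OF card_of_mono1 card_x])
  have "\<exists>\<gamma>\<in>elts b. \<forall>(\<alpha>, \<beta>)\<in>T. app c \<beta> = b \<longrightarrow> i \<beta> \<alpha> \<in> elts \<gamma>" if b: "b \<in> B" for b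
  proof -
    \<comment> \<open>Each \<alpha> contributes at most one index, so there are fewer than \<theta>
      \<le> \<open>b\<close> of them; this is why \<open>regulars\<close> starts at
      \<theta>.\<close>
    define I where "I = {\<xi>. \<exists>(\<alpha>, \<beta>)\<in>T. app c \<beta> = b \<and> \<xi> = i \<beta> \<alpha>}"
    have b_reg: "b \<in> Reg" "b \<in> elts \<mu>" "b \<notin> elts \<theta>" using b by (auto simp: B_def A_def regulars_def)
    have "I \<subseteq> (\<lambda>\<alpha>. i (t \<alpha>) \<alpha>) ` x" unfolding I_def using t T_x(1) by blast
    then have "|I| <o |elts \<theta>|" by (rule ordLeq_ordLess_trans[OF card_of_mono1 card_x])
    moreover have "|elts \<theta>| \<le>o |elts b|"
      using not_in_\<theta>D[OF b_reg(2,3)] by (intro card_of_mono1) (simp add: less_eq_hset_def)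
    ultimately have "|I| <o |elts b|" by (rule ordLess_ordLeq_trans)
    moreover have "I \<subseteq> elts b" unfolding I_def using i T_x by blast
    ultimately obtain \<gamma> where "\<gamma> \<in> elts b" "I \<subseteq> elts \<gamma>" using Reg_bounded[OF b_reg(1)] by metis
    then show ?thesis unfolding I_def by blast
  qed
  then obtain G where G: "\<And>b. b \<in> B \<Longrightarrow> G b \<in> elts b"
    and G_bound: "\<And>\<alpha> \<beta>. (\<alpha>, \<beta>) \<in> T \<Longrightarrow> app c \<beta> \<in> B \<Longrightarrow> i \<beta> \<alpha> \<in> elts (G (app c \<beta>))"
    by (metis (mono_tags, lifting) case_prodD)
  obtain g where g: "is_function_on g (hset_of B)" "\<And>b. b \<in> B \<Longrightarrow> app g b = G b"
    using hset_function[of "hset_of B" G] elts_B by metis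
  have "g \<in> prod_set (hset_of B)" unfolding prod_set_def using g G elts_B by simp
  then obtain F0 \<zeta> where F0: "F0 \<subseteq> M \<inter> prod_set (hset_of A)" "|F0| <o |elts \<sigma>|" and \<zeta>: "\<zeta> \<in> elts \<mu>"
    and dom: "\<And>b. b \<in> B \<Longrightarrow> b \<notin> elts \<zeta> \<Longrightarrow> \<exists>f\<in>F0. G b < app f b"
    using cof[unfolded cofinal_mod_bounded_def, rule_format, of "hset_of B" g] B_A card_B g(2)
    unfolding elts_A elts_B by (metis DiffI)

  \<comment> \<open>The larger of \<zeta> and \<theta>: a value of \<open>c\<close> on
    \<open>N\<close> outside \<open>Z\<close> is regular and lies where the functions in
    \<open>F0\<close> dominate \<open>G\<close>.\<close>
  define Z where "Z = (if \<zeta> \<le> \<theta> then \<theta> else \<zeta>)"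
  have Ord_\<zeta>: "Ord \<zeta>" using Ord_in_Ord[OF Ord_\<mu> \<zeta>] .
  have Z: "Z \<in> elts \<mu>" "\<theta> \<le> Z" "\<zeta> \<le> Z"
    using \<zeta> \<theta>_in_\<mu> Ord_not_le_iff[OF Ord_\<zeta> Ord_\<theta>] Ord_mem_imp_le[OF Ord_\<zeta>] by (auto simp: Z_def)
  \<comment> \<open>\<open>N0\<close> collects the ladder values at all indices below
    \<open>Z\<close>; \<open>N1 f\<close> takes, for each \<beta>, the ladder value at the index
    that \<open>f\<close> assigns to the value of \<open>c\<close> at \<beta>.\<close>
  define N0 where "N0 = {\<gamma> \<in> elts \<mu>. \<exists>\<beta>\<in>elts N. \<exists>\<xi>\<in>elts Z. opair (opair \<beta> \<xi>) \<gamma> \<in> elts E}"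
  define N1 where "N1 f = {\<gamma> \<in> elts \<mu>. \<exists>\<beta>\<in>elts N. \<exists>b\<in>elts \<mu>. \<exists>\<xi>\<in>elts b.
    opair \<beta> b \<in> elts c \<and> opair b \<xi> \<in> elts f \<and> opair (opair \<beta> \<xi>) \<gamma> \<in> elts E}" for f
  have N_sub: "N0 \<subseteq> elts \<mu>" "\<And>f. N1 f \<subseteq> elts \<mu>" by (auto simp: N0_def N1_def)
  have elts_N: "elts (hset_of N0) = N0" "\<And>f. elts (hset_of (N1 f)) = N1 f"
    by (rule elts_subset_\<mu>, rule N_sub)+
  have N0_M: "hset_of N0 \<in> M"
  proof -
    define v where "v = (\<lambda>_::nat. \<mu>)(3 := N, 4 := Z, 5 := E)"
    define p where "p = Conj (Mem 0 2) (Exists 6 (Conj (Mem 6 3) (Exists 7 (Conj (Mem 7 4) (Opair2_in 6 7 0 5)))))"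
    have v: "range v \<subseteq> M" using cE N(1) \<mu>_in_M mem_\<mu>_in_M[OF Z(1)] by (auto simp: v_def)
    show ?thesis
    proof (rule subset_\<mu>_in_M[OF v N_sub(1), where p = p])
      fix y z assume "y \<in> H \<chi>" "z \<in> H \<chi>"
      then show "sat (H \<chi>) (v(1 := z, 0 := y)) p \<longleftrightarrow> y \<in> N0"
        using M_in_H cE(2) N(1) mem_\<mu>_in_M[OF Z(1)]
        by (simp add: N0_def p_def v_def transitive_class_H transitive_class_quantifiers cong: ball_cong bex_cong)
    qed
  qed
  have N1_M: "hset_of (N1 f) \<in> M" if "f \<in> M" for f
  proof -
    define v where "v = (\<lambda>_::nat. \<mu>)(3 := N, 4 := c, 5 := f, 6 := E)"
    define p where "p = Conj (Mem 0 2) (Exists 7 (Conj (Mem 7 3) (Exists 8 (Conj (Mem 8 2) (Exists 9 (Conj (Mem 9 8)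
      (Conj (Opair_in 7 8 4) (Conj (Opair_in 8 9 5) (Opair2_in 7 9 0 6)))))))))"
    have v: "range v \<subseteq> M" using cE N(1) \<mu>_in_M that by (auto simp: v_def)
    show ?thesis
    proof (rule subset_\<mu>_in_M[OF v N_sub(2), where p = p])
      fix y z assume "y \<in> H \<chi>" "z \<in> H \<chi>"
      then show "sat (H \<chi>) (v(1 := z, 0 := y)) p \<longleftrightarrow> y \<in> N1 f"
        using M_in_H cE(1,2) N(1) \<mu>_in_M that
        by (simp add: N1_def p_def v_def transitive_class_H transitive_class_quantifiers cong: ball_cong bex_cong)
    qed
  qed
  have N1_card: "|N1 f| <o |elts \<mu>|" if "f \<in> F0" for f
  proof -
    have "single_valued_hset f" using F0(1) that prod_set_single_valued by blast
    then have "N1 f \<subseteq> (\<lambda>\<beta>. app E (opair \<beta> (app f (app c \<beta>)))) ` elts N"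
      unfolding N1_def using app_eqI[OF sv(1)] app_eqI[OF sv(2)] app_eqI[of f] by blast
    then show ?thesis
      by (rule ordLeq_ordLess_trans[OF card_of_mono1 ordLeq_ordLess_trans[OF card_of_image N(3)]])
  qed
  have N0_card: "|N0| <o |elts \<mu>|"
  proof -
    have card_Z: "|elts Z| <o |elts \<mu>|" using \<mu>_Card Z(1) by (simp add: Card_def)
    have "infinite (elts Z)"
      using Z(2) \<theta>_Reg by (auto simp: less_eq_hset_def Reg_def dest: finite_subset)
    \<comment> \<open>\<open>N\<close> may be finite, as it is at the start of the iteration;
      adjoining the infinite \<open>Z\<close> makes the library's bound for unions
      applicable.\<close>
    then have inf: "infinite (elts N \<union> elts Z)" by simp
    have "N0 \<subseteq> (\<Union>\<beta>\<in>elts N. (\<lambda>\<xi>. app E (opair \<beta> \<xi>)) ` elts Z)"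
      unfolding N0_def using app_eqI[OF sv(2)] by blast
    then have "|N0| \<le>o |\<Union>\<beta>\<in>elts N. (\<lambda>\<xi>. app E (opair \<beta> \<xi>)) ` elts Z|" by (rule card_of_mono1)
    also have "|\<Union>\<beta>\<in>elts N. (\<lambda>\<xi>. app E (opair \<beta> \<xi>)) ` elts Z| \<le>o |elts N \<union> elts Z|"
      by (rule card_of_UNION_ordLeq_infinite[OF inf])
        (auto intro: card_of_mono1 ordLeq_transitive[OF card_of_image])
    also have "|elts N \<union> elts Z| <o |elts \<mu>|"
      by (rule card_of_Un_ordLess_infinite[OF infinite_\<mu> N(3) card_Z])
    finally show ?thesis .
  qed

  define S where "S = {hset_of N0} \<union> (\<lambda>f. hset_of (N1 f)) ` F0"
  have "infinite (elts \<sigma>)" using \<sigma>_Reg by (simp add: Reg_def)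
  then have S_card: "|S| <o |elts \<sigma>|"
    unfolding S_def
    by (rule card_of_Un_ordLess_infinite)
      (auto intro: finite_card_less[OF \<sigma>_Reg] ordLeq_ordLess_trans[OF card_of_image F0(2)])
  have S_sub: "S \<subseteq> M \<inter> subsets_lt \<mu> \<mu>"
    using F0(1) N0_M N1_M N_sub N0_card N1_card by (auto simp: S_def subsets_lt_def elts_N dest: subsetD[OF N_sub(2)])
  have "\<exists>N'\<in>S. \<exists>\<gamma>\<in>elts N'. \<alpha> \<le> \<gamma> \<and> \<gamma> \<in> elts \<beta>" if "(\<alpha>, \<beta>) \<in> T" for \<alpha> \<beta>
  proof -
    note T = T_x[OF that]
    have \<beta>: "\<beta> \<in> elts (succ \<mu>)" using T(2) N(2) by blast
    show ?thesis
    proof (cases "app c \<beta> \<in> elts Z")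
      case True
      obtain \<gamma> where \<gamma>: "\<gamma> \<in> elts \<beta>" "\<alpha> \<le> \<gamma>" "opair (opair \<beta> (i \<beta> \<alpha>)) \<gamma> \<in> elts E"
        using tail[OF T(2,3) i[OF T(2,3)]] by auto
      have "i \<beta> \<alpha> \<in> elts Z"
        using Ord_Transset[OF Ord_in_Ord[OF Ord_\<mu> Z(1)] True i[OF T(2,3)]] .
      then have "\<gamma> \<in> N0" unfolding N0_def using succ_\<mu>D(3)[OF \<beta> \<gamma>(1)] T(2) \<gamma>(3) by blast
      then show ?thesis using \<gamma> elts_N(1) unfolding S_def by blast
    next
      case False
      then have nin: "app c \<beta> \<notin> elts \<theta>" "app c \<beta> \<notin> elts \<zeta>" using Z(2,3) by (auto simp: less_eq_hset_def)
      then have A: "app c \<beta> \<in> A" unfolding A_def using ladder(1,2)[OF T(2)] T(2) by blast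
      then have B: "app c \<beta> \<in> B" unfolding B_def using that by blast
      obtain f where f: "f \<in> F0" "G (app c \<beta>) < app f (app c \<beta>)" using dom[OF B nin(2)] by blast
      let ?\<xi> = "app f (app c \<beta>)"
      have fA: "?\<xi> \<in> elts (app c \<beta>)" "opair (app c \<beta>) ?\<xi> \<in> elts f"
        using prod_setD[of f "hset_of A"] F0(1) f(1) A elts_A by blast+
      have "Ord ?\<xi>" using Ord_in_Ord[OF Ord_in_Ord[OF Ord_\<mu> app_c_\<mu>[OF T(2)]] fA(1)] .
      moreover have "i \<beta> \<alpha> \<in> elts ?\<xi>" using G_bound[OF that B] f(2) by (auto simp: less_hset_def)
      \<comment> \<open>The function \<open>f\<close> only overestimates the required index; tail
        domination still yields a ladder value in the interval from \<alpha> to \<beta>.\<close>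
      ultimately have "i \<beta> \<alpha> \<le> ?\<xi>" by (rule Ord_mem_imp_le)
      then obtain \<gamma> where \<gamma>: "\<gamma> \<in> elts \<beta>" "\<alpha> \<le> \<gamma>" "opair (opair \<beta> ?\<xi>) \<gamma> \<in> elts E"
        using tail[OF T(2,3) fA(1)] by blast
      have "\<gamma> \<in> N1 f"
        unfolding N1_def using succ_\<mu>D(3)[OF \<beta> \<gamma>(1)] T(2) \<gamma>(3) fA app_c_\<mu>[OF T(2)] ladder(1)[OF T(2)] by blast
      then show ?thesis using \<gamma> elts_N(2) f(1) unfolding S_def by blast
    qed
  qed
  then have "refines x N S" unfolding refines_def T_def by blast
  then show thesis by (rule that[OF S_sub S_card])
qed

section \<open>Iteration of the refinement\<close>

lemma singleton_\<mu>_in_M: "hset_of {\<mu>} \<in> M"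
proof (rule elem_submodel_definable[OF elem transitive_class_H, of "\<lambda>_. \<mu>" _ "Eq 0 2"])
  show "hset_of {\<mu>} \<in> H \<chi>"
    using M_in_H[OF \<mu>_in_M] by (intro hset_of_in_H[OF \<chi>_Reg] finite_card_less[OF \<chi>_Reg]) auto
qed (use \<mu>_in_M in \<open>auto simp: elts_singleton\<close>)

text \<open>This is the uncountability of \<sigma> in the form required by \<open>Reg_UNION\<close>
  for a union over all finite stages.\<close>

lemma nat_card_less_\<sigma>: "|UNIV :: nat set| <o |elts \<sigma>|"
proof -
  have \<sigma>: "Ord \<sigma>" "infinite (elts \<sigma>)" using \<sigma>_Reg Reg_Ord by (auto simp: Reg_def)
  then have a: "Ord (aleph0 :: 'k hset)" "infinite (elts (aleph0 :: 'k hset))"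
    using Ord_LeastI[of "\<lambda>\<alpha>. infinite (elts \<alpha>)" \<sigma>] unfolding aleph0_def by blast+
  then have "|UNIV :: nat set| \<le>o |elts (aleph0 :: 'k hset)|" using infinite_iff_card_of_nat by blast
  moreover have "|elts (aleph0 :: 'k hset)| <o |elts \<sigma>|"
    using Ord_less_iff[OF a(1) \<sigma>(1)] aleph0_less \<sigma>_Reg by (simp add: Reg_def Card_def)
  ultimately show ?thesis by (rule ordLeq_ordLess_trans)
qed

lemma covering: "covers \<sigma> (M \<inter> subsets_lt \<mu> \<mu>) (subsets_lt \<mu> \<theta>)"
  unfolding covers_def
proof
  fix x assume "x \<in> subsets_lt \<mu> \<theta>"
  then have x: "elts x \<subseteq> elts \<mu>" "|elts x| <o |elts \<theta>|" by (auto simp: subsets_lt_def)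
  obtain c E where cE: "c \<in> M" "E \<in> M" "ladder_system c E" using ladder_system_in_M by blast
  \<comment> \<open>The bound is \<open>succ \<mu>\<close> because the initial set contains \<mu>
    itself, which provides an element above every \<alpha>.\<close>
  define good where "good = {N \<in> M. elts N \<subseteq> elts (succ \<mu>) \<and> |elts N| <o |elts \<mu>| }"
  have "\<forall>N\<in>good. \<exists>S. S \<subseteq> M \<inter> subsets_lt \<mu> \<mu> \<and> |S| <o |elts \<sigma>| \<and> refines (elts x) N S"
    using refinement_step[OF cE _ _ _ x(2)] unfolding good_def by (metis (no_types, lifting) mem_Collect_eq)
  then obtain S where S: "\<And>N. N \<in> good \<Longrightarrow> S N \<subseteq> M \<inter> subsets_lt \<mu> \<mu>"
    and S_card: "\<And>N. N \<in> good \<Longrightarrow> |S N| <o |elts \<sigma>|"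
    and S_refines: "\<And>N. N \<in> good \<Longrightarrow> refines (elts x) N (S N)"
    by metis
  have sub_good: "M \<inter> subsets_lt \<mu> \<mu> \<subseteq> good"
    by (auto simp: good_def subsets_lt_def elts_succ)
  define F where "F = rec_nat {hset_of {\<mu>}} (\<lambda>_ F. \<Union>N\<in>F. S N)"
  have F_0: "F 0 = {hset_of {\<mu>}}" and F_Suc: "F (Suc n) = (\<Union>N\<in>F n. S N)" for n by (simp_all add: F_def)
  have F: "F n \<subseteq> good \<and> |F n| <o |elts \<sigma>|" for n
  proof (induction n)
    case 0
    have "|{\<mu>}| <o |elts \<mu>|"
      using infinite_\<mu> by (meson card_of_Well_order card_of_ordLeq_infinite finite.intros not_ordLess_iff_ordLeq)
    then have "hset_of {\<mu>} \<in> good"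
      using singleton_\<mu>_in_M by (simp add: good_def elts_singleton elts_succ)
    then show ?case using finite_card_less[OF \<sigma>_Reg, of "F 0"] by (simp add: F_0)
  next
    case (Suc n)
    then have "|F (Suc n)| <o |elts \<sigma>|"
      unfolding F_Suc using S_card by (intro Reg_UNION[OF \<sigma>_Reg]) blast+
    moreover have "F (Suc n) \<subseteq> good" unfolding F_Suc using S Suc sub_good by blast
    ultimately show ?case by blast
  qed
  \<comment> \<open>Stage 0 is left out: its only member \<open>{\<mu>}\<close> is not a subset of
    \<mu>.\<close>
  define C where "C = (\<Union>n. F (Suc n))"
  have C_sub: "C \<subseteq> M \<inter> subsets_lt \<mu> \<mu>" unfolding C_def F_Suc using F S by blast
  have C_card: "|C| <o |elts \<sigma>|"
    unfolding C_def using F by (intro Reg_UNION[OF \<sigma>_Reg nat_card_less_\<sigma>]) blast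
  have "\<exists>N\<in>C. \<alpha> \<in> elts N" if \<alpha>: "\<alpha> \<in> elts x" for \<alpha>
  proof -
    have \<alpha>\<mu>: "\<alpha> \<in> elts \<mu>" using x \<alpha> by blast
    then have Ord_\<alpha>: "Ord \<alpha>" by (rule Ord_in_Ord[OF Ord_\<mu>])
    \<comment> \<open>The minimum is taken over all stages at once: if it lay strictly above
      \<alpha>, refining its stage once more would give a smaller element of
      \<open>V\<close>.\<close>
    define V where "V = {\<beta>. \<alpha> \<le> \<beta> \<and> (\<exists>n. \<exists>N\<in>F n. \<beta> \<in> elts N)}"
    have "\<mu> \<in> V" unfolding V_def using Ord_mem_imp_le[OF Ord_\<mu> \<alpha>\<mu>] F_0 elts_singleton[of \<mu>] by blast
    moreover have V_Ord: "Ord \<beta>" if "\<beta> \<in> V" for \<beta>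
      using that F succ_\<mu>D(2) unfolding V_def good_def by blast
    ultimately obtain m where m: "m \<in> V" "\<And>\<beta>. \<beta> \<in> V \<Longrightarrow> m \<le> \<beta>" using Ord_exists_least[of \<mu> V] by metis
    then obtain n N where N: "N \<in> F n" "m \<in> elts N" "\<alpha> \<le> m" unfolding V_def by blast
    have "\<alpha> \<notin> elts m"
    proof
      assume "\<alpha> \<in> elts m"
      moreover have "m \<le> \<beta>'" if "\<beta>' \<in> elts N" "\<alpha> \<le> \<beta>'" for \<beta>' using m(2) that N(1) unfolding V_def by blast
      ultimately obtain N' \<gamma> where N': "N' \<in> S N" "\<gamma> \<in> elts N'" "\<alpha> \<le> \<gamma>" "\<gamma> \<in> elts m"
        using S_refines[of N] F[of n] N \<alpha> unfolding refines_def by blast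
      then have "\<gamma> \<in> V" unfolding V_def using F_Suc[of n] N(1) by blast
      then show False using m(2) N'(4) mem_irrefl[of \<gamma>] unfolding less_eq_hset_def by blast
    qed
    then have "\<alpha> = m" using Ord_le_cases[OF V_Ord[OF m(1)] Ord_\<alpha> N(3)] by blast
    \<comment> \<open>Stage 0 contributes only \<mu>, while \<alpha> is below \<mu>; so \<alpha>
      occurs at a later stage, that is, in a member of \<open>C\<close>.\<close>
    moreover have "n \<noteq> 0" using \<open>\<alpha> = m\<close> N \<alpha>\<mu> mem_irrefl[of \<mu>] elts_singleton[of \<mu>] F_0 by auto
    ultimately show ?thesis using N unfolding C_def by (metis UN_I UNIV_I not0_implies_Suc)
  qed
  then have "elts x \<subseteq> (\<Union>c\<in>C. elts c)" by blast
  with C_sub C_card show "\<exists>C\<subseteq>M \<inter> subsets_lt \<mu> \<mu>. |C| <o |elts \<sigma>| \<and> elts x \<subseteq> (\<Union>c\<in>C. elts c)"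
    by (intro exI[of _ C] conjI)
qed

end

theorem theorem5p2:
  fixes \<sigma> \<theta> \<mu> \<chi> :: "'k hset" and M :: "'k hset set"
  assumes "\<sigma> \<in> Reg" and "\<theta> \<in> Reg" and "Card \<mu>"
    and "aleph0 < \<sigma>" and "\<sigma> \<le> cf \<mu>" and "cf \<mu> < \<theta>" and "\<theta> < \<mu>"
    and "\<chi> \<in> Reg" and "\<mu> < \<chi>"
    and "elem_submodel M (H \<chi>)" and "elts (succ \<mu>) \<subseteq> M"
    and "\<forall>A\<in>M. elts A \<subseteq> elts \<mu> \<inter> Reg \<and> |elts A| <o |elts \<mu>|
           \<longrightarrow> cofinal_mod_bounded \<theta> \<sigma> \<mu> (M \<inter> prod_set A) A"
  shows "covers \<sigma> (M \<inter> subsets_lt \<mu> \<mu>) (subsets_lt \<mu> \<theta>)"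
proof -
  interpret elementary_covering \<sigma> \<theta> \<mu> \<chi> M
    by standard (use assms in blast)+
  show ?thesis by (rule covering)
qed

end
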